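(* Let $g_t$ be a smooth family of metrics on a foliated manifold $(M,\mathcal{F})$, adapted to $(\mathcal{D},\mathcal{D}_{\mathcal{F}})$, satisfying $\partial_t g=s\,g^\perp$ for a certain $t$-dependent function $s$ on $M$. Then $$\partial_t h_{\mathcal{F}}=-s\,h_{\mathcal{F}},\qquad \partial_t H_{\mathcal{F}}=-s\,H_{\mathcal{F}} .$$ Hence, such variations of metrics preserve harmonic and totally geodesic foliations.
   Context: $M$ is a closed $(n+p)$-dimensional manifold with a $p$-dimensional foliation $\mathcal{F}$; $\mathcal{D}_{\mathcal{F}}$ is the distribution tangent to $\mathcal{F}$ and $\mathcal{D}$ a fixed complementary distribution. A metric $g$ is adapted to $(\mathcal{D},\mathcal{D}_{\mathcal{F}})$ if $\mathcal{D}$ and $\mathcal{D}_{\mathcal{F}}$ are $g$-orthogonal. $(\cdot)^\perp$ is projection onto $\mathcal{D}$ and $g^\perp(X_1,X_2)=g(X_1^\perp,X_2^\perp)$. With $\nabla$ the Levi-Civita connection of $g$, $h_{\mathcal{F}}(X,Y)=(\nabla_XY)^\perp$ for $X,Y\in\mathcal{D}_{\mathcal{F}}$ and $H_{\mathcal{F}}=\mathrm{Tr}_g h_{\mathcal{F}}$. $\mathcal{F}$ is totally geodesic if $h_{\mathcal{F}}=0$ and harmonic if $H_{\mathcal{F}}=0$. Everything is smooth. *)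

theory Defs
  imports "HOL-Analysis.Analysis" "HOL-Library.Function_Algebras"
begin

instantiation "fun" :: (type, real_vector) real_vector
begin

definition scaleR_fun :: "real \<Rightarrow> ('a \<Rightarrow> 'b) \<Rightarrow> 'a \<Rightarrow> 'b"
  where "scaleR_fun c f = (\<lambda>x. c *\<^sub>R f x)"

instance
  by standard (simp_all add: scaleR_fun_def plus_fun_def scaleR_add_right scaleR_add_left)

end


section \<open>Smooth maps between Euclidean spaces\<close>

primrec cdiff_on ::
  "nat \<Rightarrow> 'e::euclidean_space set \<Rightarrow> ('e \<Rightarrow> 'b::real_normed_vector) \<Rightarrow> bool"
  where
    "cdiff_on 0 S f \<longleftrightarrow> continuous_on S f"
  | "cdiff_on (Suc k) S f \<longleftrightarrow>
       (\<forall>x\<in>S. f differentiable (at x)) \<and>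
       (\<forall>v. cdiff_on k S (\<lambda>x. frechet_derivative f (at x) v))"

text \<open>Only used for open \<open>S\<close>.\<close>

definition smooth_on :: "'e::euclidean_space set \<Rightarrow> ('e \<Rightarrow> 'b::real_normed_vector) \<Rightarrow> bool"
  where "smooth_on S f \<longleftrightarrow> (\<forall>k. cdiff_on k S f)"


section \<open>Manifolds\<close>

text \<open>The underlying set of a manifold is a whole type \<open>'a\<close>. A chart is a pair \<open>(U, \<phi>)\<close>; the values
  of \<open>\<phi>\<close> outside \<open>U\<close> are irrelevant.\<close>

type_synonym ('a, 'e) chart = "'a set \<times> ('a \<Rightarrow> 'e)"

definition is_chart :: "('a::topological_space, 'e::euclidean_space) chart \<Rightarrow> bool"
  where "is_chart c \<longleftrightarrow> (case c of (U, \<phi>) \<Rightarrow>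
    open U \<and> open (\<phi> ` U) \<and> (\<exists>\<psi>. homeomorphism U (\<phi> ` U) \<phi> \<psi>))"

definition smooth_atlas :: "('a::topological_space, 'e::euclidean_space) chart set \<Rightarrow> bool"
  where "smooth_atlas A \<longleftrightarrow>
    (\<forall>c\<in>A. is_chart c) \<and> (\<Union>(U, \<phi>)\<in>A. U) = UNIV \<and>
    (\<forall>(U, \<phi>)\<in>A. \<forall>(V, \<theta>)\<in>A. smooth_on (\<phi> ` (U \<inter> V)) (\<theta> \<circ> inv_into U \<phi>))"

definition closed_manifold :: "('a::t2_space, 'e::euclidean_space) chart set \<Rightarrow> bool"
  where "closed_manifold A \<longleftrightarrow> smooth_atlas A \<and> compact (UNIV :: 'a set)"

definition smooth_fun_on ::
  "('a::topological_space, 'e::euclidean_space) chart set \<Rightarrow> 'a set \<Rightarrow> ('a \<Rightarrow> real) \<Rightarrow> bool"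
  where "smooth_fun_on A U f \<longleftrightarrow>
    (\<forall>(V, \<phi>)\<in>A. smooth_on (\<phi> ` (U \<inter> V)) (f \<circ> inv_into V \<phi>))"

definition smooth_near ::
  "('a::topological_space, 'e::euclidean_space) chart set \<Rightarrow> 'a \<Rightarrow> ('a \<Rightarrow> real) \<Rightarrow> bool"
  where "smooth_near A x f \<longleftrightarrow> (\<exists>U. open U \<and> x \<in> U \<and> smooth_fun_on A U f)"

text \<open>Joint smoothness of \<open>(t, x) \<mapsto> f t x\<close> on \<open>I \<times> U\<close>.\<close>

definition smooth_family_on ::
  "('a::topological_space, 'e::euclidean_space) chart set \<Rightarrow> real set \<Rightarrow> 'a set
    \<Rightarrow> (real \<Rightarrow> 'a \<Rightarrow> real) \<Rightarrow> bool"
  where "smooth_family_on A I U f \<longleftrightarrow>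
    (\<forall>(V, \<phi>)\<in>A. smooth_on (I \<times> \<phi> ` (U \<inter> V)) (\<lambda>(t, z). f t (inv_into V \<phi> z)))"


section \<open>Tangent vectors and vector fields\<close>

text \<open>Tangent vectors at \<open>x\<close> are the derivations of the algebra of germs at \<open>x\<close> of smooth functions.
  They are represented as functionals on all functions, set to \<open>0\<close> on functions that are not smooth
  near \<open>x\<close>, so that equality of tangent vectors is equality of functionals.\<close>

type_synonym 'a tvec = "('a \<Rightarrow> real) \<Rightarrow> real"

definition tangent_space ::
  "('a::topological_space, 'e::euclidean_space) chart set \<Rightarrow> 'a \<Rightarrow> 'a tvec set"
  where "tangent_space A x = {v.
    (\<forall>f g. smooth_near A x f \<longrightarrow> smooth_near A x g \<longrightarrow> v (\<lambda>y. f y + g y) = v f + v g) \<and>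
    (\<forall>c f. smooth_near A x f \<longrightarrow> v (\<lambda>y. c * f y) = c * v f) \<and>
    (\<forall>f g. smooth_near A x f \<longrightarrow> smooth_near A x g \<longrightarrow>
        v (\<lambda>y. f y * g y) = f x * v g + g x * v f) \<and>
    (\<forall>f g. smooth_near A x f \<longrightarrow> smooth_near A x g \<longrightarrow>
        eventually (\<lambda>y. f y = g y) (nhds x) \<longrightarrow> v f = v g) \<and>
    (\<forall>f. \<not> smooth_near A x f \<longrightarrow> v f = 0)}"

definition vector_field_on ::
  "('a::topological_space, 'e::euclidean_space) chart set \<Rightarrow> 'a set \<Rightarrow> ('a \<Rightarrow> 'a tvec) \<Rightarrow> bool"
  where "vector_field_on A U X \<longleftrightarrow>
    (\<forall>x\<in>U. X x \<in> tangent_space A x) \<and>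
    (\<forall>W f. open W \<longrightarrow> W \<subseteq> U \<longrightarrow> smooth_fun_on A W f \<longrightarrow> smooth_fun_on A W (\<lambda>x. X x f))"

definition lie_bracket ::
  "('a::topological_space, 'e::euclidean_space) chart set
    \<Rightarrow> ('a \<Rightarrow> 'a tvec) \<Rightarrow> ('a \<Rightarrow> 'a tvec) \<Rightarrow> 'a \<Rightarrow> 'a tvec"
  where "lie_bracket A X Y x =
    (\<lambda>f. if smooth_near A x f then X x (\<lambda>y. Y y f) - Y x (\<lambda>y. X y f) else 0)"

text \<open>The derivative of a curve in the finite-dimensional space \<open>tangent_space A x\<close>. The functionals
  \<open>v \<mapsto> v f\<close> separate points and hence span the dual space, so this is the usual notion.\<close>

definition has_tvec_derivative :: "(real \<Rightarrow> 'a tvec) \<Rightarrow> 'a tvec \<Rightarrow> real \<Rightarrow> bool"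
  where "has_tvec_derivative c v t \<longleftrightarrow>
    (\<forall>f. ((\<lambda>\<tau>. c \<tau> f) has_real_derivative v f) (at t))"


section \<open>Distributions and foliations\<close>

definition section_on ::
  "('a::topological_space, 'e::euclidean_space) chart set \<Rightarrow> ('a \<Rightarrow> 'a tvec set)
    \<Rightarrow> 'a set \<Rightarrow> ('a \<Rightarrow> 'a tvec) \<Rightarrow> bool"
  where "section_on A D U X \<longleftrightarrow> vector_field_on A U X \<and> (\<forall>x\<in>U. X x \<in> D x)"

definition smooth_distribution ::
  "('a::topological_space, 'e::euclidean_space) chart set \<Rightarrow> nat \<Rightarrow> ('a \<Rightarrow> 'a tvec set) \<Rightarrow> bool"
  where "smooth_distribution A k D \<longleftrightarrow>
    (\<forall>x. D x \<subseteq> tangent_space A x) \<and>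
    (\<forall>x. \<exists>U E. open U \<and> x \<in> U \<and> (\<forall>i<k. vector_field_on A U (E i)) \<and>
      (\<forall>y\<in>U. inj_on (\<lambda>i. E i y) {..<k} \<and> independent ((\<lambda>i. E i y) ` {..<k}) \<and>
        D y = span ((\<lambda>i. E i y) ` {..<k})))"

definition complementary ::
  "('a::topological_space, 'e::euclidean_space) chart set
    \<Rightarrow> ('a \<Rightarrow> 'a tvec set) \<Rightarrow> ('a \<Rightarrow> 'a tvec set) \<Rightarrow> bool"
  where "complementary A D D' \<longleftrightarrow>
    (\<forall>x. D x \<inter> D' x = {0} \<and> tangent_space A x = {u + w | u w. u \<in> D x \<and> w \<in> D' x})"

text \<open>The projection onto \<open>D x\<close> along \<open>D' x\<close>.\<close>

definition proj_along ::
  "('a \<Rightarrow> 'a tvec set) \<Rightarrow> ('a \<Rightarrow> 'a tvec set) \<Rightarrow> 'a \<Rightarrow> 'a tvec \<Rightarrow> 'a tvec"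
  where "proj_along D D' x v = (THE u. u \<in> D x \<and> v - u \<in> D' x)"

text \<open>A \<open>p\<close>-dimensional foliation of a \<open>(p + n)\<close>-manifold with smooth atlas \<open>A\<close> is given by a foliated
  atlas: charts into \<open>\<real>\<^sup>p \<times> \<real>\<^sup>n\<close>, compatible with \<open>A\<close>, whose transition maps are locally of the form
  \<open>(a, b) \<mapsto> (\<alpha>(a, b), \<beta>(b))\<close>. The leaves are locally the plaques on which \<open>snd \<circ> \<phi>\<close> is constant.\<close>

definition foliated_atlas ::
  "('a::topological_space, (real^'p) \<times> (real^'n)) chart set
    \<Rightarrow> ('a, (real^'p) \<times> (real^'n)) chart set \<Rightarrow> bool"
  where "foliated_atlas A \<F> \<longleftrightarrow>
    smooth_atlas (A \<union> \<F>) \<and> (\<Union>(U, \<phi>)\<in>\<F>. U) = UNIV \<and>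
    (\<forall>(U, \<phi>)\<in>\<F>. \<forall>(V, \<theta>)\<in>\<F>. \<forall>x \<in> U \<inter> V. \<exists>W. open W \<and> x \<in> W \<and> W \<subseteq> U \<inter> V \<and>
      (\<forall>y\<in>W. \<forall>z\<in>W. snd (\<phi> y) = snd (\<phi> z) \<longrightarrow> snd (\<theta> y) = snd (\<theta> z)))"

text \<open>The tangent space at \<open>x\<close> of the plaque through \<open>x\<close>, i.e. the kernel of the differential of
  \<open>snd \<circ> \<phi>\<close>.\<close>

definition tangent_distribution ::
  "('a::topological_space, (real^'p) \<times> (real^'n)) chart set
    \<Rightarrow> ('a, (real^'p) \<times> (real^'n)) chart set \<Rightarrow> 'a \<Rightarrow> 'a tvec set"
  where "tangent_distribution A \<F> x =
    {v \<in> tangent_space A x. \<forall>(U, \<phi>)\<in>\<F>. x \<in> U \<longrightarrow> (\<forall>j. v (\<lambda>y. snd (\<phi> y) $ j) = 0)}"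


section \<open>Metrics and connections\<close>

type_synonym 'a metric = "'a \<Rightarrow> 'a tvec \<Rightarrow> 'a tvec \<Rightarrow> real"

definition riemannian_metric ::
  "('a::topological_space, 'e::euclidean_space) chart set \<Rightarrow> 'a metric \<Rightarrow> bool"
  where "riemannian_metric A g \<longleftrightarrow>
    (\<forall>x. \<forall>u\<in>tangent_space A x. \<forall>v\<in>tangent_space A x. \<forall>w\<in>tangent_space A x. \<forall>a b.
      g x (a *\<^sub>R u + b *\<^sub>R v) w = a * g x u w + b * g x v w) \<and>
    (\<forall>x. \<forall>u\<in>tangent_space A x. \<forall>v\<in>tangent_space A x. g x u v = g x v u) \<and>
    (\<forall>x. \<forall>v\<in>tangent_space A x. v \<noteq> 0 \<longrightarrow> g x v v > 0) \<and>
    (\<forall>U X Y. open U \<longrightarrow> vector_field_on A U X \<longrightarrow> vector_field_on A U Y \<longrightarrow>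
      smooth_fun_on A U (\<lambda>x. g x (X x) (Y x)))"

definition smooth_metric_family ::
  "('a::topological_space, 'e::euclidean_space) chart set \<Rightarrow> real set \<Rightarrow> (real \<Rightarrow> 'a metric) \<Rightarrow> bool"
  where "smooth_metric_family A I g \<longleftrightarrow>
    (\<forall>t\<in>I. riemannian_metric A (g t)) \<and>
    (\<forall>U X Y. open U \<longrightarrow> vector_field_on A U X \<longrightarrow> vector_field_on A U Y \<longrightarrow>
      smooth_family_on A I U (\<lambda>t x. g t x (X x) (Y x)))"

definition adapted :: "('a \<Rightarrow> 'a tvec set) \<Rightarrow> ('a \<Rightarrow> 'a tvec set) \<Rightarrow> 'a metric \<Rightarrow> bool"
  where "adapted D D' g \<longleftrightarrow> (\<forall>x. \<forall>u\<in>D x. \<forall>w\<in>D' x. g x u w = 0)"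

definition perp_metric ::
  "('a \<Rightarrow> 'a tvec set) \<Rightarrow> ('a \<Rightarrow> 'a tvec set) \<Rightarrow> 'a metric \<Rightarrow> 'a metric"
  where "perp_metric D D' g x v w = g x (proj_along D D' x v) (proj_along D D' x w)"

text \<open>\<open>nabla x v Y\<close> is the covariant derivative at \<open>x\<close> of \<open>Y\<close> in the direction of the tangent vector
  \<open>v\<close> at \<open>x\<close>, where \<open>Y\<close> is a vector field defined on some neighbourhood of \<open>x\<close>. So
  \<open>(\<nabla>\<^sub>X Y) x\<close> is \<open>nabla x (X x) Y\<close>.\<close>

type_synonym 'a connection = "'a \<Rightarrow> 'a tvec \<Rightarrow> ('a \<Rightarrow> 'a tvec) \<Rightarrow> 'a tvec"

definition affine_connection ::
  "('a::topological_space, 'e::euclidean_space) chart set \<Rightarrow> 'a connection \<Rightarrow> bool"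
  where "affine_connection A nabla \<longleftrightarrow>
    (\<forall>U x v Y. open U \<longrightarrow> x \<in> U \<longrightarrow> v \<in> tangent_space A x \<longrightarrow> vector_field_on A U Y \<longrightarrow>
      nabla x v Y \<in> tangent_space A x) \<and>
    (\<forall>U x v w Y a b. open U \<longrightarrow> x \<in> U \<longrightarrow> v \<in> tangent_space A x \<longrightarrow> w \<in> tangent_space A x \<longrightarrow>
      vector_field_on A U Y \<longrightarrow>
      nabla x (a *\<^sub>R v + b *\<^sub>R w) Y = a *\<^sub>R nabla x v Y + b *\<^sub>R nabla x w Y) \<and>
    (\<forall>U x v Y Z. open U \<longrightarrow> x \<in> U \<longrightarrow> v \<in> tangent_space A x \<longrightarrow>
      vector_field_on A U Y \<longrightarrow> vector_field_on A U Z \<longrightarrow>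
      nabla x v (\<lambda>y. Y y + Z y) = nabla x v Y + nabla x v Z) \<and>
    (\<forall>U x v f Y. open U \<longrightarrow> x \<in> U \<longrightarrow> v \<in> tangent_space A x \<longrightarrow>
      smooth_fun_on A U f \<longrightarrow> vector_field_on A U Y \<longrightarrow>
      nabla x v (\<lambda>y. f y *\<^sub>R Y y) = v f *\<^sub>R Y x + f x *\<^sub>R nabla x v Y) \<and>
    (\<forall>U x v Y Z. open U \<longrightarrow> x \<in> U \<longrightarrow> v \<in> tangent_space A x \<longrightarrow>
      vector_field_on A U Y \<longrightarrow> vector_field_on A U Z \<longrightarrow> (\<forall>y\<in>U. Y y = Z y) \<longrightarrow>
      nabla x v Y = nabla x v Z) \<and>
    (\<forall>U X Y. open U \<longrightarrow> vector_field_on A U X \<longrightarrow> vector_field_on A U Y \<longrightarrow>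
      vector_field_on A U (\<lambda>x. nabla x (X x) Y))"

definition levi_civita ::
  "('a::topological_space, 'e::euclidean_space) chart set \<Rightarrow> 'a metric \<Rightarrow> 'a connection \<Rightarrow> bool"
  where "levi_civita A g nabla \<longleftrightarrow>
    affine_connection A nabla \<and>
    (\<forall>U X Y. open U \<longrightarrow> vector_field_on A U X \<longrightarrow> vector_field_on A U Y \<longrightarrow>
      (\<forall>x\<in>U. nabla x (X x) Y - nabla x (Y x) X = lie_bracket A X Y x)) \<and>
    (\<forall>U Y Z. open U \<longrightarrow> vector_field_on A U Y \<longrightarrow> vector_field_on A U Z \<longrightarrow>
      (\<forall>x\<in>U. \<forall>v\<in>tangent_space A x.
        v (\<lambda>y. g y (Y y) (Z y)) = g x (nabla x v Y) (Z x) + g x (Y x) (nabla x v Z)))"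


section \<open>Second fundamental form and mean curvature of a foliation\<close>

text \<open>Here \<open>D'\<close> is the distribution tangent to the foliation, and \<open>D\<close> the complementary one. The
  arguments \<open>X\<close> and \<open>Y\<close> are sections of \<open>D'\<close> near \<open>x\<close>.\<close>

definition second_fundamental_form ::
  "('a \<Rightarrow> 'a tvec set) \<Rightarrow> ('a \<Rightarrow> 'a tvec set) \<Rightarrow> 'a connection
    \<Rightarrow> ('a \<Rightarrow> 'a tvec) \<Rightarrow> ('a \<Rightarrow> 'a tvec) \<Rightarrow> 'a \<Rightarrow> 'a tvec"
  where "second_fundamental_form D D' nabla X Y x = proj_along D D' x (nabla x (X x) Y)"

text \<open>The second fundamental form is tensorial on \<open>D'\<close>, so its trace at \<open>x\<close> is obtained by extending
  the vectors of a \<open>g x\<close>-orthonormal basis of \<open>D' x\<close> to sections of \<open>D'\<close> near \<open>x\<close>; neither choice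
  affects the result.\<close>

definition local_extension ::
  "('a::topological_space, 'e::euclidean_space) chart set
    \<Rightarrow> ('a \<Rightarrow> 'a tvec set) \<Rightarrow> 'a \<Rightarrow> 'a tvec \<Rightarrow> 'a \<Rightarrow> 'a tvec"
  where "local_extension A D' x v =
    (SOME X. X x = v \<and> (\<exists>U. open U \<and> x \<in> U \<and> section_on A D' U X))"

definition orthonormal_basis :: "('a tvec \<Rightarrow> 'a tvec \<Rightarrow> real) \<Rightarrow> 'a tvec set \<Rightarrow> 'a tvec set \<Rightarrow> bool"
  where "orthonormal_basis q V B \<longleftrightarrow>
    finite B \<and> B \<subseteq> V \<and> V \<subseteq> span B \<and> (\<forall>u\<in>B. \<forall>w\<in>B. q u w = (if u = w then 1 else 0))"

definition mean_curvature ::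
  "('a::topological_space, 'e::euclidean_space) chart set
    \<Rightarrow> ('a \<Rightarrow> 'a tvec set) \<Rightarrow> ('a \<Rightarrow> 'a tvec set) \<Rightarrow> 'a metric \<Rightarrow> 'a connection \<Rightarrow> 'a \<Rightarrow> 'a tvec"
  where "mean_curvature A D D' g nabla x =
    (\<Sum>e \<in> (SOME B. orthonormal_basis (g x) (D' x) B).
      second_fundamental_form D D' nabla (local_extension A D' x e) (local_extension A D' x e) x)"

definition totally_geodesic ::
  "('a::topological_space, 'e::euclidean_space) chart set
    \<Rightarrow> ('a \<Rightarrow> 'a tvec set) \<Rightarrow> ('a \<Rightarrow> 'a tvec set) \<Rightarrow> 'a connection \<Rightarrow> bool"
  where "totally_geodesic A D D' nabla \<longleftrightarrow>
    (\<forall>U X Y. open U \<longrightarrow> section_on A D' U X \<longrightarrow> section_on A D' U Y \<longrightarrow>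
      (\<forall>x\<in>U. second_fundamental_form D D' nabla X Y x = 0))"

definition harmonic ::
  "('a::topological_space, 'e::euclidean_space) chart set
    \<Rightarrow> ('a \<Rightarrow> 'a tvec set) \<Rightarrow> ('a \<Rightarrow> 'a tvec set) \<Rightarrow> 'a metric \<Rightarrow> 'a connection \<Rightarrow> bool"
  where "harmonic A D D' g nabla \<longleftrightarrow> (\<forall>x. mean_curvature A D D' g nabla x = 0)"

end

theory Submission
  imports Defs
begin

text \<open>
  Write \<open>\<nabla>\<^sup>t\<close> and \<open>h\<^sub>t\<close> for the Levi-Civita connection and the second fundamental form at time \<open>t\<close>, and let
  \<open>X\<close>, \<open>Y\<close> be tangent to the leaves. The argument is by an explicit formula for \<open>h\<^sub>\<tau>\<close> rather than by
  differentiating \<open>\<nabla>\<^sup>\<tau>\<close> in \<open>\<tau>\<close>, so that no regularity of \<open>\<tau> \<mapsto> \<nabla>\<^sup>\<tau>\<close> has to be discussed.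

  The variation \<open>s g\<^sup>\<perp>\<close> vanishes as soon as one argument is tangent to the leaves, so \<open>g\<^sub>\<tau>(u, \<cdot>)\<close> is constant
  in \<open>\<tau>\<close> for such \<open>u\<close>. For a section \<open>Z\<close> of \<open>D\<close>, Koszul's formula collapses, by orthogonality and
  by involutivity of the leaf distribution, to
  \<open>2 g\<^sub>\<tau>(\<nabla>\<^sup>\<tau>\<^sub>X Y, Z) = - g\<^sub>\<tau>(Y, [X, Z]) - g\<^sub>\<tau>(X, [Y, Z]) - Z g\<^sub>\<tau>(X, Y)\<close>, in which every
  metric term has an argument tangent to the leaves. Hence \<open>g\<^sub>\<tau>(h\<^sub>\<tau>(X, Y), Z)\<close> is constant in \<open>\<tau>\<close>
  (\<open>normal_component_constant\<close>). On \<open>D\<close>, on the other hand, all functions \<open>\<tau> \<mapsto> g\<^sub>\<tau>(u, w)\<close> at a point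
  solve the same scalar linear equation \<open>y' = s y\<close>, so \<open>g\<^sub>\<tau> = E(\<tau>) g\<^sub>t\<close> there with \<open>E > 0\<close>, \<open>E(t) = 1\<close>,
  \<open>E'(t) = s\<close> (\<open>conformal_factor\<close>). Comparing the two, \<open>h\<^sub>t = E(\<tau>) h\<^sub>\<tau>\<close>
  (\<open>second_fundamental_form_rescaled\<close>), from which the derivative of \<open>h\<close> and the preservation of
  totally geodesic foliations can be read off.

  The leaf metric does not move, so an orthonormal basis of the leaf distribution serves for all times
  and the mean curvature is rescaled by the same factor. For the mean curvature to mean anything here,
  such a basis must exist and its vectors must extend to local sections. Both rest on the fact that a
  derivation of germs is a directional derivative in any chart (\<open>tangent_eq_coord_field\<close>), that is, on
  Hadamard's lemma. In a foliated chart, fields with constant coefficients along the plaques then provide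
  the extensions, and the tangent space is finite-dimensional.
\<close>

section \<open>Calculus of smooth maps\<close>

lemma cdiff_on_subset: "cdiff_on k S f \<Longrightarrow> T \<subseteq> S \<Longrightarrow> cdiff_on k T f"
  by (induction k arbitrary: f) (auto intro: continuous_on_subset)

lemma frechet_derivative_cong_open:
  assumes "open S" "x \<in> S" "\<And>y. y \<in> S \<Longrightarrow> f y = g y"
  shows "frechet_derivative f (at x) = frechet_derivative g (at x)"
proof -
  have "(f has_derivative d) (at x) \<longleftrightarrow> (g has_derivative d) (at x)" for d
    using has_derivative_transform_within_open[OF _ assms(1,2)] assms(3) by metis
  then show ?thesis by (simp add: frechet_derivative_def)
qed

lemma cdiff_on_SucD:
  assumes "cdiff_on (Suc k) S f" "x \<in> S"
  shows "(f has_derivative frechet_derivative f (at x)) (at x)"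
  using assms by (simp add: frechet_derivative_works[symmetric])

lemma cdiff_on_cong:
  assumes "open S" "\<And>y. y \<in> S \<Longrightarrow> f y = g y" "cdiff_on k S f"
  shows "cdiff_on k S g"
  using assms(2,3)
proof (induction k arbitrary: f g)
  case 0
  then show ?case using continuous_on_cong[OF refl, of S f g] by simp
next
  case (Suc k)
  have "g differentiable at x" if "x \<in> S" for x
  proof -
    have "(g has_derivative frechet_derivative f (at x)) (at x)"
      by (rule has_derivative_transform_within_open[OF cdiff_on_SucD[OF Suc.prems(2) that] \<open>open S\<close> that])
        (rule Suc.prems(1))
    then show ?thesis by (rule differentiableI)
  qed
  moreover have "cdiff_on k S (\<lambda>x. frechet_derivative g (at x) v)" for v
  proof (rule Suc.IH)
    show "frechet_derivative f (at y) v = frechet_derivative g (at y) v" if "y \<in> S" for y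
      by (simp only: frechet_derivative_cong_open[OF \<open>open S\<close> that Suc.prems(1)])
    show "cdiff_on k S (\<lambda>x. frechet_derivative f (at x) v)"
      using Suc.prems(2) by simp
  qed
  ultimately show ?case by simp
qed

text \<open>Smoothness is local; this is what lets a function be tested in the charts of an atlas one at a
  time.\<close>

lemma cdiff_on_Union:
  assumes "\<And>S. S \<in> \<C> \<Longrightarrow> open S" "\<And>S. S \<in> \<C> \<Longrightarrow> cdiff_on k S f"
  shows "cdiff_on k (\<Union>\<C>) f"
  using assms(2)
proof (induction k arbitrary: f)
  case 0
  then show ?case using continuous_on_open_Union[of \<C> f] assms(1) by simp
next
  case (Suc k)
  then show ?case by auto
qed

text \<open>Allows any formula for the derivative to replace the chosen one, which is the only convenient way
  to climb one order of differentiability.\<close>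

lemma cdiff_on_SucI:
  assumes "open S" "\<And>x. x \<in> S \<Longrightarrow> (f has_derivative d x) (at x)"
    and "\<And>v. cdiff_on k S (\<lambda>x. d x v)"
  shows "cdiff_on (Suc k) S f"
proof -
  have "d x = frechet_derivative f (at x)" if "x \<in> S" for x
    using assms(2)[OF that] by (rule frechet_derivative_at)
  then have "cdiff_on k S (\<lambda>x. frechet_derivative f (at x) v)" for v
    by (intro cdiff_on_cong[OF assms(1) _ assms(3)[of v]]) simp
  then show ?thesis using assms(2) by (auto simp: differentiable_def)
qed

lemma cdiff_on_Suc_imp: "cdiff_on (Suc k) S f \<Longrightarrow> cdiff_on k S f"
proof (induction k arbitrary: f)
  case 0
  then show ?case
    by (simp add: continuous_at_imp_continuous_on differentiable_imp_continuous_within)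
next
  case (Suc k)
  then show ?case by (simp only: cdiff_on.simps) blast
qed

lemma cdiff_on_const: "open S \<Longrightarrow> cdiff_on k S (\<lambda>x. c)"
proof (induction k arbitrary: c)
  case (Suc k)
  then show ?case by (intro cdiff_on_SucI[where d = "\<lambda>x v. 0"]) auto
qed simp

lemma cdiff_on_add:
  "open S \<Longrightarrow> cdiff_on k S f \<Longrightarrow> cdiff_on k S g \<Longrightarrow> cdiff_on k S (\<lambda>x. f x + g x)"
proof (induction k arbitrary: f g)
  case 0 then show ?case by (simp add: continuous_on_add)
next
  case (Suc k)
  show ?case
    by (rule cdiff_on_SucI[OF \<open>open S\<close>
          has_derivative_add[OF cdiff_on_SucD[OF Suc.prems(2)] cdiff_on_SucD[OF Suc.prems(3)]]])
      (use Suc in auto)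
qed

lemma cdiff_on_sum:
  assumes "open S" "finite J" "\<And>j. j \<in> J \<Longrightarrow> cdiff_on k S (f j)"
  shows "cdiff_on k S (\<lambda>x. \<Sum>j\<in>J. f j x)"
  using assms(2,3,1)
  by (induction J rule: finite_induct) (auto intro: cdiff_on_add cdiff_on_const)

lemma cdiff_on_bilinear:
  assumes "bounded_bilinear B" "open S"
  shows "cdiff_on k S f \<Longrightarrow> cdiff_on k S g \<Longrightarrow> cdiff_on k S (\<lambda>x. B (f x) (g x))"
proof (induction k arbitrary: f g)
  case 0 then show ?case by (simp add: bounded_bilinear.continuous_on[OF assms(1)])
next
  case (Suc k)
  show ?case
  proof (rule cdiff_on_SucI[OF assms(2)
          bounded_bilinear.FDERIV[OF assms(1) cdiff_on_SucD[OF Suc.prems(1)] cdiff_on_SucD[OF Suc.prems(2)]]])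
    fix v
    show "cdiff_on k S (\<lambda>x. B (f x) (frechet_derivative g (at x) v) + B (frechet_derivative f (at x) v) (g x))"
      using Suc.prems Suc.prems[THEN cdiff_on_Suc_imp]
      by (intro cdiff_on_add Suc.IH assms(2)) auto
  qed
qed

lemma cdiff_on_bounded_linear:
  assumes "bounded_linear L" "open S"
  shows "cdiff_on k S L"
proof (cases k)
  case 0 then show ?thesis using assms by (simp add: linear_continuous_on)
next
  case (Suc l)
  show ?thesis unfolding Suc
    by (rule cdiff_on_SucI[OF assms(2) bounded_linear_imp_has_derivative[OF assms(1)]])
      (rule cdiff_on_const[OF assms(2)])
qed

lemma linear_basis_sum:
  fixes v :: "'e::euclidean_space"
  assumes "linear d"
  shows "d v = (\<Sum>b\<in>Basis. (v \<bullet> b) *\<^sub>R d b)"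
proof -
  have "d v = d (\<Sum>b\<in>Basis. (v \<bullet> b) *\<^sub>R b)" by (simp add: euclidean_representation)
  also have "\<dots> = (\<Sum>b\<in>Basis. (v \<bullet> b) *\<^sub>R d b)"
    using assms by (simp add: linear_sum linear_cmul)
  finally show ?thesis .
qed

text \<open>Expanding the chain rule in a basis writes the derivative as a sum of products of a derivative of
  \<open>f\<close> with a composition of one order less, so that induction applies.\<close>

lemma cdiff_on_compose:
  fixes f :: "'e::euclidean_space \<Rightarrow> 'f::euclidean_space"
  assumes "open S" "open T" "f ` S \<subseteq> T"
  shows "cdiff_on k S f \<Longrightarrow> cdiff_on k T g \<Longrightarrow> cdiff_on k S (\<lambda>x. g (f x))"
proof (induction k arbitrary: g)
  case 0 then show ?case using continuous_on_compose2 assms(3) by auto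
next
  case (Suc k)
  define d where "d x v = (\<Sum>b\<in>Basis. (frechet_derivative f (at x) v \<bullet> b) *\<^sub>R frechet_derivative g (at (f x)) b)" for x v
  have "((\<lambda>x. g (f x)) has_derivative d x) (at x)" if "x \<in> S" for x
  proof -
    have g: "(g has_derivative frechet_derivative g (at (f x))) (at (f x))"
      using cdiff_on_SucD[OF Suc.prems(2)] assms(3) that by blast
    have "d x = (\<lambda>v. frechet_derivative g (at (f x)) (frechet_derivative f (at x) v))"
      unfolding d_def using linear_basis_sum[OF has_derivative_linear[OF g]] by metis
    then show ?thesis
      using has_derivative_compose[OF cdiff_on_SucD[OF Suc.prems(1) that] g] by simp
  qed
  then show ?case
  proof (rule cdiff_on_SucI[OF assms(1)])
    fix v
    have "cdiff_on k S (\<lambda>x. frechet_derivative g (at (f x)) b)" for b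
      using Suc.IH[of "\<lambda>y. frechet_derivative g (at y) b"] Suc.prems cdiff_on_Suc_imp by auto
    moreover have "cdiff_on k S (\<lambda>x. frechet_derivative f (at x) v \<bullet> b)" for b
      using Suc.prems(1) assms(1)
      by (auto intro!: cdiff_on_bilinear[OF bounded_bilinear_inner] cdiff_on_const)
    ultimately show "cdiff_on k S (\<lambda>x. d x v)"
      unfolding d_def
      by (intro cdiff_on_sum cdiff_on_bilinear[OF bounded_bilinear_scaleR] assms(1)) auto
  qed
qed

lemma smooth_onI: "(\<And>k. cdiff_on k S f) \<Longrightarrow> smooth_on S f" by (simp add: smooth_on_def)

lemma smooth_on_subset: "smooth_on S f \<Longrightarrow> T \<subseteq> S \<Longrightarrow> smooth_on T f"
  unfolding smooth_on_def using cdiff_on_subset by blast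

lemma smooth_on_cong:
  assumes "open S" "\<And>y. y \<in> S \<Longrightarrow> f y = g y" "smooth_on S f"
  shows "smooth_on S g"
  unfolding smooth_on_def
proof
  fix k show "cdiff_on k S g"
    by (rule cdiff_on_cong[OF assms(1,2)]) (use assms(3) in \<open>simp_all add: smooth_on_def\<close>)
qed

lemma smooth_on_has_derivative:
  "smooth_on S f \<Longrightarrow> x \<in> S \<Longrightarrow> (f has_derivative frechet_derivative f (at x)) (at x)"
  by (rule cdiff_on_SucD[of 0]) (simp_all only: smooth_on_def)

lemma smooth_on_directional_derivative:
  "smooth_on S f \<Longrightarrow> smooth_on S (\<lambda>x. frechet_derivative f (at x) v)"
  unfolding smooth_on_def using cdiff_on.simps(2) by blast

lemma smooth_on_continuous: "smooth_on S f \<Longrightarrow> continuous_on S f"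
  unfolding smooth_on_def using cdiff_on.simps(1) by blast

text \<open>Differentiation under the integral sign. The chain rule contributes a factor \<open>t\<close>;
  carrying the weight \<open>t ^ m\<close> along makes the derivative an integral of the same kind, so that
  the step can be iterated.\<close>

lemma has_derivative_segment_integral:
  fixes H :: "'e::euclidean_space \<Rightarrow> real"
  assumes "open S" "convex S" "a \<in> S" "smooth_on S H" "z \<in> S"
  shows "((\<lambda>z. integral {0..1} (\<lambda>t. t ^ m * H (a + t *\<^sub>R (z - a)))) has_derivative
    (\<lambda>v. integral {0..1} (\<lambda>t. t ^ Suc m * frechet_derivative H (at (a + t *\<^sub>R (z - a))) v))) (at z)"
proof -
  define dH where "dH x = frechet_derivative H (at x)" for x
  have mem: "a + t *\<^sub>R (z - a) \<in> S" if "z \<in> S" "t \<in> {0..1}" for z t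
  proof -
    have "(1 - t) *\<^sub>R a + t *\<^sub>R z \<in> S"
      using assms(2,3) that by (intro convexD_alt) auto
    then show ?thesis by (simp add: algebra_simps)
  qed
  have dH: "(H has_derivative dH x) (at x)" if "x \<in> S" for x
    unfolding dH_def by (rule smooth_on_has_derivative[OF assms(4) that])
  have contH: "continuous_on S H" by (rule smooth_on_continuous[OF assms(4)])
  have contdH: "continuous_on S (\<lambda>x. dH x v)" for v
    unfolding dH_def by (intro smooth_on_continuous smooth_on_directional_derivative assms(4))
  \<comment> \<open>The Leibniz rule wants the derivative of the integrand as a continuous curve of bounded linear maps.\<close>
  define fx where "fx z t = Blinfun (\<lambda>v. t ^ Suc m * dH (a + t *\<^sub>R (z - a)) v)" for z t
  have fx: "blinfun_apply (fx z t) v = t ^ Suc m * dH (a + t *\<^sub>R (z - a)) v"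
    if "z \<in> S" "t \<in> {0..1}" for z t v
  proof -
    have "bounded_linear (\<lambda>v. t ^ Suc m * dH (a + t *\<^sub>R (z - a)) v)"
      by (intro bounded_linear_const_mult has_derivative_bounded_linear[OF dH] mem that)
    then show ?thesis unfolding fx_def by (simp add: bounded_linear_Blinfun_apply)
  qed
  have seg: "continuous_on (S \<times> {0..1}) (\<lambda>(z, t). a + t *\<^sub>R (z - a))"
    by (auto simp: case_prod_unfold intro!: continuous_intros)
  have contfx: "continuous_on (S \<times> {0..1}) (\<lambda>(z, t). fx z t)"
  proof (rule continuous_on_blinfun_componentwise)
    fix i :: 'e
    have "continuous_on (S \<times> {0..1}) (\<lambda>p. snd p ^ Suc m * dH (case p of (z, t) \<Rightarrow> a + t *\<^sub>R (z - a)) i)"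
      using mem by (intro continuous_intros continuous_on_compose2[OF contdH seg]) auto
    then show "continuous_on (S \<times> {0..1}) (\<lambda>p. blinfun_apply (case p of (z, t) \<Rightarrow> fx z t) i)"
      by (rule continuous_on_eq) (auto simp: fx)
  qed
  have int: "(\<lambda>t. t ^ m * H (a + t *\<^sub>R (z - a))) integrable_on cbox 0 1" if "z \<in> S" for z
    using mem[OF that]
    by (intro integrable_continuous continuous_intros continuous_on_compose2[OF contH]) auto
  have "((\<lambda>z. integral (cbox 0 1) (\<lambda>t. t ^ m * H (a + t *\<^sub>R (z - a)))) has_derivative
      blinfun_apply (integral (cbox 0 1) (fx z))) (at z within S)"
  proof (rule leibniz_rule[OF _ int])
    fix z and t :: real assume z: "z \<in> S" and t: "t \<in> cbox 0 1"
    have "((\<lambda>z. t ^ m * H (a + t *\<^sub>R (z - a))) has_derivative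
        (\<lambda>v. t ^ m * dH (a + t *\<^sub>R (z - a)) (t *\<^sub>R v))) (at z within S)"
      using mem[OF z] t
      by (auto intro!: derivative_eq_intros has_derivative_compose[OF _ dH, of _ _ z S])
    moreover have "(\<lambda>v. t ^ m * dH (a + t *\<^sub>R (z - a)) (t *\<^sub>R v)) = blinfun_apply (fx z t)"
      using t fx[OF z] linear_cmul[OF has_derivative_linear[OF dH[OF mem[OF z]]]] by (auto simp: fun_eq_iff)
    ultimately show "((\<lambda>z. t ^ m * H (a + t *\<^sub>R (z - a))) has_derivative blinfun_apply (fx z t)) (at z within S)"
      by simp
  qed (use contfx assms in auto)
  moreover have "blinfun_apply (integral (cbox 0 1) (fx z)) =
      (\<lambda>v. integral {0..1} (\<lambda>t. t ^ Suc m * dH (a + t *\<^sub>R (z - a)) v))"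
  proof
    fix v
    have "fx z integrable_on cbox 0 1"
      using assms(5)
      by (intro integrable_continuous continuous_on_compose2[OF contfx, of _ "\<lambda>t. (z, t)", simplified])
        (auto intro!: continuous_intros)
    then have "blinfun_apply (integral (cbox 0 1) (fx z)) v = integral (cbox 0 1) (\<lambda>t. blinfun_apply (fx z t) v)"
      by (rule blinfun_apply_integral)
    also have "\<dots> = integral {0..1} (\<lambda>t. t ^ Suc m * dH (a + t *\<^sub>R (z - a)) v)"
      using fx[OF assms(5)] by (auto intro!: integral_cong)
    finally show "blinfun_apply (integral (cbox 0 1) (fx z)) v = \<dots>" .
  qed
  ultimately show ?thesis
    using at_within_open[OF assms(5,1)] by (simp add: dH_def)
qed

lemma smooth_on_segment_integral:
  fixes H :: "'e::euclidean_space \<Rightarrow> real"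
  assumes "open S" "convex S" "a \<in> S" "smooth_on S H"
  shows "smooth_on S (\<lambda>z. integral {0..1} (\<lambda>t. t ^ m * H (a + t *\<^sub>R (z - a))))"
proof (rule smooth_onI)
  fix k
  show "cdiff_on k S (\<lambda>z. integral {0..1} (\<lambda>t. t ^ m * H (a + t *\<^sub>R (z - a))))"
    using assms(4)
  proof (induction k arbitrary: m H)
    case 0
    have "continuous (at z) (\<lambda>z. integral {0..1} (\<lambda>t. t ^ m * H (a + t *\<^sub>R (z - a))))" if "z \<in> S" for z
      by (rule has_derivative_continuous[OF has_derivative_segment_integral[OF assms(1-3) 0 that]])
    then show ?case by (simp add: continuous_at_imp_continuous_on)
  next
    case (Suc k)
    show ?case
      by (rule cdiff_on_SucI[OF assms(1) has_derivative_segment_integral[OF assms(1-3) Suc.prems]])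
        (auto simp del: power_Suc intro!: Suc.IH smooth_on_directional_derivative Suc.prems)
  qed
qed

text \<open>The factors are \<open>G b z = \<integral> \<partial>\<^sub>b F (a + t (z - a)) dt\<close> over
  \<open>[0, 1]\<close>, by the fundamental theorem of calculus along the segment from \<open>a\<close> to
  \<open>z\<close>.\<close>

lemma hadamard_factorization:
  fixes F :: "'e::euclidean_space \<Rightarrow> real"
  assumes "open S" "convex S" "a \<in> S" "smooth_on S F"
  obtains G where "\<And>b. smooth_on S (G b)"
    and "\<And>z. z \<in> S \<Longrightarrow> F z = F a + (\<Sum>b\<in>Basis. ((z - a) \<bullet> b) * G b z)"
    and "\<And>b. G b a = frechet_derivative F (at a) b"
proof
  define G where "G b z = integral {0..1} (\<lambda>t. t ^ 0 * frechet_derivative F (at (a + t *\<^sub>R (z - a))) b)" for b z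
  show "smooth_on S (G b)" for b
    unfolding G_def using smooth_on_segment_integral[OF assms(1-3) smooth_on_directional_derivative[OF assms(4)]]
    by blast
  show "G b a = frechet_derivative F (at a) b" for b by (simp add: G_def)
  show "F z = F a + (\<Sum>b\<in>Basis. ((z - a) \<bullet> b) * G b z)" if z: "z \<in> S" for z
  proof -
    define dF where "dF t = frechet_derivative F (at (a + t *\<^sub>R (z - a)))" for t
    have mem: "a + t *\<^sub>R (z - a) \<in> S" if "t \<in> {0..1}" for t
    proof -
      have "(1 - t) *\<^sub>R a + t *\<^sub>R z \<in> S"
        using assms(2,3) that z by (intro convexD_alt) auto
      then show ?thesis by (simp add: algebra_simps)
    qed
    have dF: "(F has_derivative dF t) (at (a + t *\<^sub>R (z - a)))" if "t \<in> {0..1}" for t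
      unfolding dF_def by (rule smooth_on_has_derivative[OF assms(4) mem[OF that]])
    have "((\<lambda>t. F (a + t *\<^sub>R (z - a))) has_vector_derivative dF t (z - a)) (at t within {0..1})"
      if t: "t \<in> {0..1}" for t
    proof -
      have "((\<lambda>t. F (a + t *\<^sub>R (z - a))) has_derivative (\<lambda>r. dF t (r *\<^sub>R (z - a)))) (at t within {0..1})"
        by (rule has_derivative_compose[of "\<lambda>t. a + t *\<^sub>R (z - a)" _ t _ F, OF _ dF[OF t]])
          (auto intro!: derivative_eq_intros)
      then show ?thesis
        using linear_cmul[OF has_derivative_linear[OF dF[OF t]]] by (simp add: has_vector_derivative_def)
    qed
    then have "((\<lambda>t. dF t (z - a)) has_integral (F (a + 1 *\<^sub>R (z - a)) - F (a + 0 *\<^sub>R (z - a)))) {0..1}"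
      by (intro fundamental_theorem_of_calculus) auto
    then have "F z - F a = integral {0..1} (\<lambda>t. dF t (z - a))" by (simp add: integral_unique)
    also have "\<dots> = integral {0..1} (\<lambda>t. \<Sum>b\<in>Basis. ((z - a) \<bullet> b) * dF t b)"
      using linear_basis_sum[OF has_derivative_linear[OF dF]] by (intro integral_cong) (simp)
    also have "\<dots> = (\<Sum>b\<in>Basis. integral {0..1} (\<lambda>t. ((z - a) \<bullet> b) * dF t b))"
    proof (rule integral_sum)
      fix b :: 'e
      have "continuous_on {0..1} (\<lambda>t. dF t b)"
        unfolding dF_def using mem
        by (intro continuous_on_compose2[OF smooth_on_continuous[OF smooth_on_directional_derivative[OF assms(4)]]])
          (auto intro!: continuous_intros)
      then show "(\<lambda>t. ((z - a) \<bullet> b) * dF t b) integrable_on {0..1}"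
        by (intro integrable_continuous_interval continuous_intros)
    qed simp
    also have "\<dots> = (\<Sum>b\<in>Basis. ((z - a) \<bullet> b) * G b z)" by (simp add: G_def dF_def)
    finally show ?thesis by simp
  qed
qed

section \<open>Charts and smooth functions on a manifold\<close>

lemma is_chartD:
  assumes "is_chart (U, \<phi>)"
  shows "open U" "open (\<phi> ` U)" "inj_on \<phi> U" "continuous_on U \<phi>"
    "continuous_on (\<phi> ` U) (inv_into U \<phi>)"
proof -
  obtain \<psi> where \<psi>: "homeomorphism U (\<phi> ` U) \<phi> \<psi>" and o: "open U" "open (\<phi> ` U)"
    using assms by (auto simp: is_chart_def)
  show inj: "inj_on \<phi> U" using \<psi> by (metis homeomorphism_apply1 inj_onI)
  show "open U" "open (\<phi> ` U)" "continuous_on U \<phi>" using o \<psi> by (auto simp: homeomorphism_def)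
  have "inv_into U \<phi> z = \<psi> z" if "z \<in> \<phi> ` U" for z
    using that \<psi> inj by (auto simp: homeomorphism_def)
  then show "continuous_on (\<phi> ` U) (inv_into U \<phi>)"
    using \<psi> continuous_on_cong by (metis homeomorphism_cont2)
qed

lemma is_chart_open_image:
  assumes "is_chart (U, \<phi>)" "open W" "W \<subseteq> U"
  shows "open (\<phi> ` W)"
proof -
  note c = is_chartD[OF assms(1)]
  have "\<phi> ` W = inv_into U \<phi> -` W \<inter> \<phi> ` U"
    using assms(3) c(3) by (auto simp: subset_iff)
  then show ?thesis using c assms(2) by (metis continuous_on_open_vimage)
qed

lemma smooth_atlasD:
  assumes "smooth_atlas A"
  shows "(U, \<phi>) \<in> A \<Longrightarrow> is_chart (U, \<phi>)"
    "(U, \<phi>) \<in> A \<Longrightarrow> (V, \<theta>) \<in> A \<Longrightarrow> smooth_on (\<phi> ` (U \<inter> V)) (\<theta> \<circ> inv_into U \<phi>)"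
    "\<exists>U \<phi>. (U, \<phi>) \<in> A \<and> x \<in> U"
proof -
  show "(U, \<phi>) \<in> A \<Longrightarrow> is_chart (U, \<phi>)"
    "(U, \<phi>) \<in> A \<Longrightarrow> (V, \<theta>) \<in> A \<Longrightarrow> smooth_on (\<phi> ` (U \<inter> V)) (\<theta> \<circ> inv_into U \<phi>)"
    using assms unfolding smooth_atlas_def by blast+
  have "x \<in> (\<Union>(U, \<phi>)\<in>A. U)" using assms by (simp add: smooth_atlas_def)
  then show "\<exists>U \<phi>. (U, \<phi>) \<in> A \<and> x \<in> U" by blast
qed

text \<open>In the second chart the coordinate expression of \<open>h\<close> is the first one precomposed
  with the transition map.\<close>

lemma smooth_on_change_chart:
  assumes "smooth_atlas B" "(U, \<phi>) \<in> B" "(V, \<theta>) \<in> B" "open W" "W \<subseteq> U"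
    and "smooth_on (\<phi> ` W) (h \<circ> inv_into U \<phi>)"
  shows "smooth_on (\<theta> ` (W \<inter> V)) (h \<circ> inv_into V \<theta>)"
proof -
  note U = smooth_atlasD(1)[OF assms(1,2)] and V = smooth_atlasD(1)[OF assms(1,3)]
  have o: "open (\<theta> ` (W \<inter> V))" using assms(4) is_chartD[OF V] by (intro is_chart_open_image[OF V]) auto
  have im: "(\<phi> \<circ> inv_into V \<theta>) ` (\<theta> ` (W \<inter> V)) \<subseteq> \<phi> ` W"
    using is_chartD(3)[OF V] by auto
  have "smooth_on (\<theta> ` (W \<inter> V)) (\<phi> \<circ> inv_into V \<theta>)"
    using assms(5) by (intro smooth_on_subset[OF smooth_atlasD(2)[OF assms(1,3,2)]]) auto
  then have sm: "smooth_on (\<theta> ` (W \<inter> V)) (\<lambda>z. (h \<circ> inv_into U \<phi>) ((\<phi> \<circ> inv_into V \<theta>) z))"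
    using assms(6) cdiff_on_compose[OF o is_chart_open_image[OF U assms(4,5)] im]
    unfolding smooth_on_def by blast
  have eq: "(h \<circ> inv_into U \<phi>) ((\<phi> \<circ> inv_into V \<theta>) z) = (h \<circ> inv_into V \<theta>) z"
    if "z \<in> \<theta> ` (W \<inter> V)" for z
  proof -
    obtain y where y: "y \<in> W" "y \<in> V" "z = \<theta> y" using \<open>z \<in> \<theta> ` (W \<inter> V)\<close> by blast
    have "inv_into V \<theta> z = y" using is_chartD(3)[OF V] y by simp
    moreover have "inv_into U \<phi> (\<phi> y) = y"
      by (rule inv_into_f_f[OF is_chartD(3)[OF U]]) (use assms(5) y in blast)
    ultimately show ?thesis by simp
  qed
  show ?thesis by (rule smooth_on_cong[OF o eq sm])
qed

lemma open_chart_image_Int: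
  assumes "smooth_atlas A" "(V, \<theta>) \<in> A" "open W"
  shows "open (\<theta> ` (W \<inter> V))"
  using assms is_chartD(1)[OF smooth_atlasD(1)[OF assms(1,2)]]
  by (intro is_chart_open_image[OF smooth_atlasD(1)[OF assms(1,2)]]) auto

lemma smooth_fun_on_subset: "smooth_fun_on A W f \<Longrightarrow> W' \<subseteq> W \<Longrightarrow> smooth_fun_on A W' f"
  unfolding smooth_fun_on_def by (fast intro: smooth_on_subset)

lemma smooth_fun_on_const: "smooth_atlas A \<Longrightarrow> open W \<Longrightarrow> smooth_fun_on A W (\<lambda>x. c)"
  unfolding smooth_fun_on_def smooth_on_def comp_def
  by (auto intro!: cdiff_on_const open_chart_image_Int[of A])

lemma smooth_fun_on_add:
  assumes "smooth_atlas A" "open W" "smooth_fun_on A W f" "smooth_fun_on A W g"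
  shows "smooth_fun_on A W (\<lambda>x. f x + g x)"
proof -
  have "cdiff_on k (\<theta> ` (W \<inter> V)) ((\<lambda>x. f x + g x) \<circ> inv_into V \<theta>)" if V: "(V, \<theta>) \<in> A" for V \<theta> k
    using assms(3,4) V unfolding smooth_fun_on_def smooth_on_def comp_def
    by (intro cdiff_on_add open_chart_image_Int[OF assms(1) V assms(2)]) auto
  then show ?thesis unfolding smooth_fun_on_def smooth_on_def by auto
qed

lemma smooth_fun_on_mult:
  assumes "smooth_atlas A" "open W" "smooth_fun_on A W f" "smooth_fun_on A W g"
  shows "smooth_fun_on A W (\<lambda>x. f x * g x)"
proof -
  have "cdiff_on k (\<theta> ` (W \<inter> V)) ((\<lambda>x. f x * g x) \<circ> inv_into V \<theta>)" if V: "(V, \<theta>) \<in> A" for V \<theta> k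
    using assms(3,4) V unfolding smooth_fun_on_def smooth_on_def comp_def
    by (intro cdiff_on_bilinear[OF bounded_bilinear_mult] open_chart_image_Int[OF assms(1) V assms(2)]) auto
  then show ?thesis unfolding smooth_fun_on_def smooth_on_def by auto
qed

lemma smooth_nearI: "open W \<Longrightarrow> x \<in> W \<Longrightarrow> smooth_fun_on A W f \<Longrightarrow> smooth_near A x f"
  unfolding smooth_near_def by blast

lemma smooth_near_const: "smooth_atlas A \<Longrightarrow> smooth_near A x (\<lambda>x. c)"
  by (rule smooth_nearI[OF open_UNIV]) (auto intro: smooth_fun_on_const)

lemma smooth_near_op:
  assumes "smooth_near A x f" "smooth_near A x g"
    and "\<And>W f g. open W \<Longrightarrow> smooth_fun_on A W f \<Longrightarrow> smooth_fun_on A W g \<Longrightarrow> smooth_fun_on A W (\<lambda>x. F (f x) (g x))"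
  shows "smooth_near A x (\<lambda>x. F (f x) (g x))"
proof -
  obtain W1 W2 where "open W1" "x \<in> W1" "smooth_fun_on A W1 f" "open W2" "x \<in> W2" "smooth_fun_on A W2 g"
    using assms(1,2) unfolding smooth_near_def by blast
  then show ?thesis
    by (intro smooth_nearI[of "W1 \<inter> W2"] assms(3)) (auto intro: smooth_fun_on_subset)
qed

lemma smooth_near_add:
  "smooth_atlas A \<Longrightarrow> smooth_near A x f \<Longrightarrow> smooth_near A x g \<Longrightarrow> smooth_near A x (\<lambda>x. f x + g x)"
  by (rule smooth_near_op) (auto intro: smooth_fun_on_add)

lemma smooth_near_mult:
  "smooth_atlas A \<Longrightarrow> smooth_near A x f \<Longrightarrow> smooth_near A x g \<Longrightarrow> smooth_near A x (\<lambda>x. f x * g x)"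
  by (rule smooth_near_op) (auto intro: smooth_fun_on_mult)

lemma smooth_near_sum:
  assumes "smooth_atlas A" "finite J" "\<And>j. j \<in> J \<Longrightarrow> smooth_near A x (f j)"
  shows "smooth_near A x (\<lambda>y. \<Sum>j\<in>J. f j y)"
  using assms(2,3,1)
  by (induction J rule: finite_induct) (auto intro: smooth_near_add smooth_near_const)

section \<open>Tangent vectors as directional derivatives\<close>

lemma tangent_spaceD:
  assumes "v \<in> tangent_space A x"
  shows "smooth_near A x f \<Longrightarrow> smooth_near A x g \<Longrightarrow> v (\<lambda>y. f y + g y) = v f + v g"
    "smooth_near A x f \<Longrightarrow> v (\<lambda>y. c * f y) = c * v f"
    "smooth_near A x f \<Longrightarrow> smooth_near A x g \<Longrightarrow> v (\<lambda>y. f y * g y) = f x * v g + g x * v f"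
    "smooth_near A x f \<Longrightarrow> smooth_near A x g \<Longrightarrow> eventually (\<lambda>y. f y = g y) (nhds x) \<Longrightarrow> v f = v g"
    "\<not> smooth_near A x f \<Longrightarrow> v f = 0"
  using assms unfolding tangent_space_def by blast+

text \<open>A derivation kills \<open>1 = 1 * 1\<close>, hence all constants, and it sees only the germ of
  \<open>f\<close>.\<close>

lemma tangent_locally_const:
  assumes "smooth_atlas A" "v \<in> tangent_space A x" "eventually (\<lambda>y. f y = c) (nhds x)"
  shows "v f = 0"
proof (cases "smooth_near A x f")
  case True
  note 1 = smooth_near_const[OF assms(1), of x]
  have "v f = v (\<lambda>y. c * 1)" using tangent_spaceD(4)[OF assms(2) True 1[of c] assms(3)] by simp
  also have "\<dots> = c * v (\<lambda>y. 1)" using tangent_spaceD(2)[OF assms(2) 1] .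
  also have "v (\<lambda>y. 1) = 0" using tangent_spaceD(3)[OF assms(2) 1[of 1] 1[of 1]] by simp
  finally show ?thesis by simp
qed (rule tangent_spaceD(5)[OF assms(2)])

lemma sum_fun_apply: "(\<Sum>j\<in>J. F j) x = (\<Sum>j\<in>J. F j x)"
  by (induction J rule: infinite_finite_induct) (auto simp: zero_fun_def plus_fun_def)

lemma tangent_sum:
  assumes "smooth_atlas A" "v \<in> tangent_space A x" "finite J" "\<And>j. j \<in> J \<Longrightarrow> smooth_near A x (f j)"
  shows "v (\<lambda>y. \<Sum>j\<in>J. f j y) = (\<Sum>j\<in>J. v (f j))"
  using assms(3,4)
proof (induction J rule: finite_induct)
  case empty
  show ?case using tangent_locally_const[OF assms(1,2), of "\<lambda>y. 0" 0] by simp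
next
  case (insert j J)
  then show ?case
    using tangent_spaceD(1)[OF assms(2) insert.prems[of j] smooth_near_sum[OF assms(1) insert(1), of x f]]
    by simp
qed

lemma tangent_spaceI:
  assumes "\<And>f g. smooth_near A x f \<Longrightarrow> smooth_near A x g \<Longrightarrow> v (\<lambda>y. f y + g y) = v f + v g"
    "\<And>c f. smooth_near A x f \<Longrightarrow> v (\<lambda>y. c * f y) = c * v f"
    "\<And>f g. smooth_near A x f \<Longrightarrow> smooth_near A x g \<Longrightarrow> v (\<lambda>y. f y * g y) = f x * v g + g x * v f"
    "\<And>f g. smooth_near A x f \<Longrightarrow> smooth_near A x g \<Longrightarrow> eventually (\<lambda>y. f y = g y) (nhds x) \<Longrightarrow> v f = v g"
    "\<And>f. \<not> smooth_near A x f \<Longrightarrow> v f = 0"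
  shows "v \<in> tangent_space A x"
  using assms unfolding tangent_space_def by blast

lemma subspace_tangent_space: "subspace (tangent_space A x)"
proof (rule subspaceI)
  show "0 \<in> tangent_space A x" by (simp add: tangent_space_def)
next
  fix u v assume uv: "u \<in> tangent_space A x" "v \<in> tangent_space A x"
  show "u + v \<in> tangent_space A x"
  proof (rule tangent_spaceI)
    fix f g c assume f: "smooth_near A x f"
    show "(u + v) (\<lambda>y. c * f y) = c * (u + v) f"
      by (simp add: uv[THEN tangent_spaceD(2), OF f] distrib_left)
    assume g: "smooth_near A x g"
    show "(u + v) (\<lambda>y. f y + g y) = (u + v) f + (u + v) g"
      by (simp add: uv[THEN tangent_spaceD(1), OF f g])
    show "(u + v) (\<lambda>y. f y * g y) = f x * (u + v) g + g x * (u + v) f"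
      by (simp add: uv[THEN tangent_spaceD(3), OF f g] distrib_left)
    assume fg: "eventually (\<lambda>y. f y = g y) (nhds x)"
    show "(u + v) f = (u + v) g" by (simp add: uv[THEN tangent_spaceD(4), OF f g fg])
  qed (simp add: uv[THEN tangent_spaceD(5)])
next
  fix a v assume v: "v \<in> tangent_space A x"
  show "a *\<^sub>R v \<in> tangent_space A x"
  proof (rule tangent_spaceI)
    fix f g c assume f: "smooth_near A x f"
    show "(a *\<^sub>R v) (\<lambda>y. c * f y) = c * (a *\<^sub>R v) f"
      by (simp add: scaleR_fun_def tangent_spaceD(2)[OF v f])
    assume g: "smooth_near A x g"
    show "(a *\<^sub>R v) (\<lambda>y. f y + g y) = (a *\<^sub>R v) f + (a *\<^sub>R v) g"
      by (simp add: scaleR_fun_def tangent_spaceD(1)[OF v f g] distrib_left)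
    show "(a *\<^sub>R v) (\<lambda>y. f y * g y) = f x * (a *\<^sub>R v) g + g x * (a *\<^sub>R v) f"
      by (simp add: scaleR_fun_def tangent_spaceD(3)[OF v f g] distrib_left)
    assume fg: "eventually (\<lambda>y. f y = g y) (nhds x)"
    show "(a *\<^sub>R v) f = (a *\<^sub>R v) g" by (simp add: scaleR_fun_def tangent_spaceD(4)[OF v f g fg])
  qed (simp add: scaleR_fun_def tangent_spaceD(5)[OF v])
qed

text \<open>A chart of the foliated atlas need not belong to the atlas \<open>A\<close> that defines
  smoothness, but it is compatible with it. For such a chart, smoothness with respect to \<open>A\<close> is
  the same as smoothness of the coordinate expression.\<close>

locale compatible_chart =
  fixes A :: "('a::topological_space, 'e::euclidean_space) chart set" and U :: "'a set" and \<phi> :: "'a \<Rightarrow> 'e"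
  assumes atlas: "smooth_atlas A" and compatible: "smooth_atlas (insert (U, \<phi>) A)"
begin

lemmas chart = smooth_atlasD(1)[OF compatible, of U \<phi>, simplified]
lemmas chartD = is_chartD[OF chart]

lemma smooth_fun_onI:
  assumes "open W" "W \<subseteq> U" "smooth_on (\<phi> ` W) (h \<circ> inv_into U \<phi>)"
  shows "smooth_fun_on A W h"
  unfolding smooth_fun_on_def
  using smooth_on_change_chart[OF compatible _ _ assms] by auto

text \<open>The image of \<open>W\<close> is covered by the images of its intersections with the charts of
  \<open>A\<close>, on each of which the change of charts applies.\<close>

lemma smooth_fun_onD:
  assumes "open W" "W \<subseteq> U" "smooth_fun_on A W h"
  shows "smooth_on (\<phi> ` W) (h \<circ> inv_into U \<phi>)"
proof (rule smooth_onI)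
  fix k
  define \<C> where "\<C> = (\<lambda>(V, \<theta>). \<phi> ` (W \<inter> V)) ` A"
  have "cdiff_on k (\<Union>\<C>) (h \<circ> inv_into U \<phi>)"
  proof (rule cdiff_on_Union)
    fix S assume "S \<in> \<C>"
    then obtain V \<theta> where V: "(V, \<theta>) \<in> A" and S: "S = \<phi> ` (W \<inter> V)" by (auto simp: \<C>_def)
    have "open V" by (rule is_chartD(1)[OF smooth_atlasD(1)[OF atlas V]])
    then have o: "open (W \<inter> V)" using assms(1) by blast
    then show "open S" unfolding S by (rule is_chart_open_image[OF chart]) (use assms in auto)
    have "smooth_on (\<theta> ` (W \<inter> V)) (h \<circ> inv_into V \<theta>)"
      using assms(3) V unfolding smooth_fun_on_def by auto
    then have "smooth_on (\<phi> ` (W \<inter> V \<inter> U)) (h \<circ> inv_into U \<phi>)"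
      using smooth_on_change_chart[OF compatible _ _ o, of V \<theta> U \<phi> h] V by auto
    moreover have "W \<inter> V \<inter> U = W \<inter> V" using assms(2) by blast
    ultimately show "cdiff_on k S (h \<circ> inv_into U \<phi>)" by (simp add: S smooth_on_def)
  qed
  moreover have "\<Union>\<C> = \<phi> ` W" using smooth_atlasD(3)[OF atlas] by (fastforce simp: \<C>_def)
  ultimately show "cdiff_on k (\<phi> ` W) (h \<circ> inv_into U \<phi>)" by simp
qed

lemma smooth_near_chart:
  assumes "y \<in> U" "smooth_near A y f"
  obtains W where "open W" "y \<in> W" "W \<subseteq> U" "smooth_fun_on A W f" "open (\<phi> ` W)"
    "smooth_on (\<phi> ` W) (f \<circ> inv_into U \<phi>)"
proof -
  obtain W where "open W" "y \<in> W" "smooth_fun_on A W f" using assms by (auto simp: smooth_near_def)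
  then have W: "open (W \<inter> U)" "y \<in> W \<inter> U" "W \<inter> U \<subseteq> U" "smooth_fun_on A (W \<inter> U) f"
    using chartD assms by (auto intro: smooth_fun_on_subset)
  show thesis
    by (rule that[OF W is_chart_open_image[OF chart W(1,3)] smooth_fun_onD[OF W(1,3,4)]])
qed

text \<open>The vector field with constant coefficients \<open>w\<close> in the chart; it vanishes on
  functions that are not smooth, as every tangent vector does.\<close>

definition coord_field :: "'e \<Rightarrow> 'a \<Rightarrow> 'a tvec" where
  "coord_field w y f =
    (if smooth_near A y f then frechet_derivative (f \<circ> inv_into U \<phi>) (at (\<phi> y)) w else 0)"

lemma has_derivative_chart:
  assumes "y \<in> U" "smooth_near A y f"
  shows "((f \<circ> inv_into U \<phi>) has_derivative (\<lambda>w. coord_field w y f)) (at (\<phi> y))"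
proof -
  obtain W where "open W" "y \<in> W" "W \<subseteq> U" "smooth_fun_on A W f" "open (\<phi> ` W)"
    "smooth_on (\<phi> ` W) (f \<circ> inv_into U \<phi>)"
    by (rule smooth_near_chart[OF assms])
  then have "((f \<circ> inv_into U \<phi>) has_derivative frechet_derivative (f \<circ> inv_into U \<phi>) (at (\<phi> y))) (at (\<phi> y))"
    by (intro smooth_on_has_derivative[of "\<phi> ` W"]) auto
  then show ?thesis using assms(2) by (simp add: coord_field_def)
qed

lemma coord_field_eqI:
  assumes "y \<in> U" "smooth_near A y f" "((f \<circ> inv_into U \<phi>) has_derivative d) (at (\<phi> y))"
  shows "coord_field w y f = d w"
  using has_derivative_unique[OF has_derivative_chart[OF assms(1,2)] assms(3)] by metis

lemma coord_field_tangent: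
  assumes y: "y \<in> U"
  shows "coord_field w y \<in> tangent_space A y"
proof -
  have inv: "inv_into U \<phi> (\<phi> y) = y" using y chartD by simp
  have "coord_field w y (\<lambda>y. f y + g y) = coord_field w y f + coord_field w y g"
    if "smooth_near A y f" "smooth_near A y g" for f g
    using has_derivative_add[OF has_derivative_chart[OF y that(1)] has_derivative_chart[OF y that(2)]]
    by (intro coord_field_eqI[OF y]) (auto simp: comp_def intro: smooth_near_add[OF atlas] that)
  moreover have "coord_field w y (\<lambda>y. f y * g y) = f y * coord_field w y g + g y * coord_field w y f"
    if "smooth_near A y f" "smooth_near A y g" for f g
    using has_derivative_mult[OF has_derivative_chart[OF y that(1)] has_derivative_chart[OF y that(2)]]
    by (intro coord_field_eqI[OF y]) (auto simp: comp_def inv algebra_simps intro: smooth_near_mult[OF atlas] that)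
  moreover have "coord_field w y (\<lambda>y. c * f y) = c * coord_field w y f"
    if "smooth_near A y f" for f c
    using has_derivative_mult_right[OF has_derivative_chart[OF y that], of c]
    by (intro coord_field_eqI[OF y])
      (auto simp: comp_def intro: smooth_near_mult[OF atlas smooth_near_const[OF atlas]] that)
  moreover have "coord_field w y f = coord_field w y g"
    if "smooth_near A y f" "smooth_near A y g" and ev: "eventually (\<lambda>y. f y = g y) (nhds y)" for f g
  proof -
    obtain W where W: "open W" "y \<in> W" "\<And>z. z \<in> W \<Longrightarrow> f z = g z"
      using ev by (auto simp: eventually_nhds)
    have o: "open (\<phi> ` (W \<inter> U))" using W chartD by (intro is_chart_open_image[OF chart]) auto
    have "((g \<circ> inv_into U \<phi>) has_derivative (\<lambda>w. coord_field w y f)) (at (\<phi> y))"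
      by (rule has_derivative_transform_within_open[OF has_derivative_chart[OF y that(1)] o])
        (use W y chartD(3) in auto)
    then show ?thesis using coord_field_eqI[OF y that(2)] by metis
  qed
  moreover have "coord_field w y f = 0" if "\<not> smooth_near A y f" for f
    using that by (simp add: coord_field_def)
  ultimately show ?thesis by (intro tangent_spaceI) blast+
qed

lemma vector_field_coord_field: "vector_field_on A U (coord_field w)"
  unfolding vector_field_on_def
proof (intro conjI ballI allI impI coord_field_tangent)
  fix W f assume W: "open W" "W \<subseteq> U" and f: "smooth_fun_on A W f"
  have "smooth_on (\<phi> ` W) (\<lambda>z. frechet_derivative (f \<circ> inv_into U \<phi>) (at z) w)"
    by (rule smooth_on_directional_derivative[OF smooth_fun_onD[OF W f]])
  moreover have "frechet_derivative (f \<circ> inv_into U \<phi>) (at z) w =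
      ((\<lambda>y. coord_field w y f) \<circ> inv_into U \<phi>) z" if "z \<in> \<phi> ` W" for z
    using that W chartD(3) smooth_nearI[OF W(1) _ f] by (auto simp: coord_field_def subset_iff)
  ultimately have "smooth_on (\<phi> ` W) ((\<lambda>y. coord_field w y f) \<circ> inv_into U \<phi>)"
    by (rule_tac smooth_on_cong[OF is_chart_open_image[OF chart W]])
  then show "smooth_fun_on A W (\<lambda>y. coord_field w y f)" by (rule smooth_fun_onI[OF W])
qed

lemma linear_coord_field:
  assumes "y \<in> U"
  shows "linear (\<lambda>w. coord_field w y)"
proof (rule linearI)
  fix w w' and c :: real
  have "linear (\<lambda>w. coord_field w y f)" for f
    using has_derivative_linear[OF has_derivative_chart[OF assms, of f]]
    by (cases "smooth_near A y f") (auto simp: coord_field_def intro: linearI)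
  note this[THEN linear_add] this[THEN linear_cmul]
  then show "coord_field (w + w') y = coord_field w y + coord_field w' y"
    "coord_field (c *\<^sub>R w) y = c *\<^sub>R coord_field w y"
    by (auto simp: fun_eq_iff plus_fun_def scaleR_fun_def)
qed

lemma coord_field_sum:
  assumes "y \<in> U"
  shows "coord_field (\<Sum>b\<in>J. r b *\<^sub>R b) y = (\<Sum>b\<in>J. r b *\<^sub>R coord_field b y)"
  by (simp only: linear_sum[OF linear_coord_field[OF assms]] linear_cmul[OF linear_coord_field[OF assms]])

lemma smooth_near_chart_component:
  assumes "x \<in> U"
  shows "smooth_near A x (\<lambda>y. (\<phi> y - c) \<bullet> b)"
proof (rule smooth_nearI[OF chartD(1) assms smooth_fun_onI[OF chartD(1) order_refl]])
  have "smooth_on (\<phi> ` U) (\<lambda>z. z \<bullet> b + (- c) \<bullet> b)"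
    unfolding smooth_on_def
    by (intro allI cdiff_on_add[OF chartD(2)] cdiff_on_const[OF chartD(2)]
        cdiff_on_bounded_linear[OF bounded_linear_inner_left chartD(2)])
  then show "smooth_on (\<phi> ` U) ((\<lambda>y. (\<phi> y - c) \<bullet> b) \<circ> inv_into U \<phi>)"
    by (rule smooth_on_cong[OF chartD(2), rotated]) (auto simp: f_inv_into_f inner_diff_left)
qed

lemma tangent_chart_component:
  assumes "x \<in> U" "v \<in> tangent_space A x"
  shows "v (\<lambda>y. (\<phi> y - c) \<bullet> b) = v (\<lambda>y. \<phi> y \<bullet> b)"
proof -
  have "v (\<lambda>y. \<phi> y \<bullet> b) = v (\<lambda>y. (\<phi> y - c) \<bullet> b + c \<bullet> b)" by (simp add: inner_diff_left)
  also have "\<dots> = v (\<lambda>y. (\<phi> y - c) \<bullet> b) + v (\<lambda>y. c \<bullet> b)"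
    by (rule tangent_spaceD(1)[OF assms(2) smooth_near_chart_component[OF assms(1)] smooth_near_const[OF atlas]])
  also have "v (\<lambda>y. c \<bullet> b) = 0" by (rule tangent_locally_const[OF atlas assms(2), of _ "c \<bullet> b"]) simp
  finally show ?thesis by simp
qed

text \<open>Hadamard's lemma writes \<open>f\<close> near \<open>x\<close> as \<open>f x\<close> plus products
  of coordinate functions vanishing at \<open>x\<close> with smooth functions. By the product rule \<open>v
  f\<close> depends only on the values of \<open>v\<close> on the coordinates and on the partial derivatives
  of \<open>f\<close> at \<open>x\<close>.\<close>

lemma tangent_eq_coord_field:
  assumes x: "x \<in> U" and v: "v \<in> tangent_space A x"
  shows "v = coord_field (\<Sum>b\<in>Basis. v (\<lambda>y. (\<phi> y - \<phi> x) \<bullet> b) *\<^sub>R b) x"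
proof
  fix f
  define l where "l b y = (\<phi> y - \<phi> x) \<bullet> b" for b y
  define w where "w = (\<Sum>b\<in>Basis. v (l b) *\<^sub>R b)"
  have inv: "inv_into U \<phi> (\<phi> y) = y" if "y \<in> U" for y using that chartD by simp
  show "v f = coord_field (\<Sum>b\<in>Basis. v (\<lambda>y. (\<phi> y - \<phi> x) \<bullet> b) *\<^sub>R b) x f"
  proof (cases "smooth_near A x f")
    case True
    define F where "F = f \<circ> inv_into U \<phi>"
    obtain W where W: "open W" "x \<in> W" "W \<subseteq> U" "smooth_fun_on A W f" "open (\<phi> ` W)"
        "smooth_on (\<phi> ` W) F"
      unfolding F_def by (rule smooth_near_chart[OF x True])
    obtain r where r: "r > 0" "ball (\<phi> x) r \<subseteq> \<phi> ` W"
      using openE[OF W(5), of "\<phi> x"] W(2) by blast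
    \<comment> \<open>Hadamard's lemma needs a convex domain.\<close>
    define S where "S = ball (\<phi> x) r"
    define W' where "W' = \<phi> -` S \<inter> U"
    have S: "open S" "convex S" "\<phi> x \<in> S" "smooth_on S F"
      using r smooth_on_subset[OF W(6)] by (auto simp: S_def)
    obtain G where G: "\<And>b. smooth_on S (G b)"
        "\<And>z. z \<in> S \<Longrightarrow> F z = F (\<phi> x) + (\<Sum>b\<in>Basis. ((z - \<phi> x) \<bullet> b) * G b z)"
        "\<And>b. G b (\<phi> x) = frechet_derivative F (at (\<phi> x)) b"
      using hadamard_factorization[OF S] by blast
    have SU: "S \<subseteq> \<phi> ` U" using r W(3) by (auto simp: S_def)
    have W': "open W'" "W' \<subseteq> U" "x \<in> W'" "\<phi> ` W' = S"
      using continuous_on_open_vimage[OF chartD(1)] chartD(4) S x SU by (auto simp: W'_def)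
    have near: "smooth_near A x h" if "smooth_on S (h \<circ> inv_into U \<phi>)" for h
      using smooth_nearI[OF W'(1,3) smooth_fun_onI[OF W'(1,2)]] that W'(4) by simp
    have l: "smooth_near A x (l b)" for b
      unfolding l_def by (rule smooth_near_chart_component[OF x])
    have g: "smooth_near A x (\<lambda>y. G b (\<phi> y))" for b
      by (rule near, rule smooth_on_cong[OF S(1) _ G(1)]) (use SU in \<open>auto simp: subset_iff f_inv_into_f\<close>)
    define h where "h y = (\<Sum>b\<in>Basis. l b y * G b (\<phi> y))" for y
    have lg: "smooth_near A x (\<lambda>y. l b y * G b (\<phi> y))" for b
      by (rule smooth_near_mult[OF atlas l g])
    have h: "smooth_near A x h" unfolding h_def by (rule smooth_near_sum[OF atlas _ lg]) simp
    have "v f = v (\<lambda>y. f x + h y)"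
    proof (rule tangent_spaceD(4)[OF v True smooth_near_add[OF atlas smooth_near_const[OF atlas] h]])
      have "f y = f x + h y" if "y \<in> W'" for y
        using G(2)[of "\<phi> y"] that W'(2,4) x inv unfolding F_def h_def l_def by (auto simp: subset_iff)
      then show "eventually (\<lambda>y. f y = f x + h y) (nhds x)"
        using W'(1,3) unfolding eventually_nhds by blast
    qed
    also have "\<dots> = v (\<lambda>y. f x) + v h"
      by (rule tangent_spaceD(1)[OF v smooth_near_const[OF atlas] h])
    also have "v (\<lambda>y. f x) = 0" by (rule tangent_locally_const[OF atlas v, of _ "f x"]) simp
    also have "v h = (\<Sum>b\<in>Basis. v (\<lambda>y. l b y * G b (\<phi> y)))"
      unfolding h_def by (rule tangent_sum[OF atlas v _ lg]) simp
    also have "\<dots> = (\<Sum>b\<in>Basis. v (l b) * coord_field b x f)"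
      using tangent_spaceD(3)[OF v l g] True
      by (intro sum.cong) (auto simp: l_def[of _ x] G(3) coord_field_def F_def)
    also have "\<dots> = (\<Sum>b\<in>Basis. v (l b) *\<^sub>R coord_field b x) f"
      by (simp add: scaleR_fun_def sum_fun_apply)
    also have "\<dots> = coord_field w x f"
      unfolding w_def coord_field_sum[OF x] ..
    finally show ?thesis by (simp add: w_def l_def[abs_def])
  qed (simp add: coord_field_def tangent_spaceD(5)[OF v])
qed

lemma tangent_space_finite_span:
  assumes "x \<in> U"
  shows "tangent_space A x \<subseteq> span ((\<lambda>b. coord_field b x) ` Basis)"
proof
  fix v assume "v \<in> tangent_space A x"
  then have "v = (\<Sum>b\<in>Basis. v (\<lambda>y. (\<phi> y - \<phi> x) \<bullet> b) *\<^sub>R coord_field b x)"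
    unfolding coord_field_sum[OF assms, symmetric] by (rule tangent_eq_coord_field[OF assms])
  also have "\<dots> \<in> span ((\<lambda>b. coord_field b x) ` Basis)"
    by (intro span_sum span_scale span_base) auto
  finally show "v \<in> span ((\<lambda>b. coord_field b x) ` Basis)" .
qed

end

section \<open>Gram-Schmidt orthonormalization\<close>

lemma orthonormal_basis_exists:
  assumes V: "subspace V" "V \<subseteq> span F" "finite F"
    and lin: "\<And>a b u v w. u \<in> V \<Longrightarrow> v \<in> V \<Longrightarrow> w \<in> V \<Longrightarrow> q (a *\<^sub>R u + b *\<^sub>R v) w = a * q u w + b * q v w"
    and sym: "\<And>u v. u \<in> V \<Longrightarrow> v \<in> V \<Longrightarrow> q u v = q v u"
    and pos: "\<And>v. v \<in> V \<Longrightarrow> v \<noteq> 0 \<Longrightarrow> q v v > 0"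
  shows "\<exists>B. orthonormal_basis q V B"
proof -
  obtain C where C: "C \<subseteq> V" "independent C" "V \<subseteq> span C" by (rule basis_exists)
  have "finite C" using independent_span_bound[OF V(3) C(2)] C(1) V(2) by blast
  then have "\<exists>B. finite B \<and> B \<subseteq> V \<and> C \<subseteq> span B \<and> (\<forall>u\<in>B. \<forall>w\<in>B. q u w = (if u = w then 1 else 0))"
    using C(1)
  proof (induction C rule: finite_induct)
    case empty
    show ?case by (intro exI[of _ "{}"]) simp
  next
    case (insert c C)
    then obtain B where B: "finite B" "B \<subseteq> V" "C \<subseteq> span B"
        and on: "\<And>u w. u \<in> B \<Longrightarrow> w \<in> B \<Longrightarrow> q u w = (if u = w then 1 else 0)"
      by auto
    have c: "c \<in> V" using insert.prems by simp
    have zero: "q 0 w = 0" if "w \<in> V" for w using lin[of 0 0 w 0 0] that V(1) by (simp add: subspace_0)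
    have q_sum: "(\<Sum>b\<in>J. r b *\<^sub>R b) \<in> V \<and> q (\<Sum>b\<in>J. r b *\<^sub>R b) w = (\<Sum>b\<in>J. r b * q b w)"
      if "finite J" "J \<subseteq> V" "w \<in> V" for J r w
      using that(1,2)
    proof (induction J rule: finite_induct)
      case empty then show ?case unfolding sum.empty using zero that(3) subspace_0[OF V(1)] by blast
    next
      case (insert j J)
      have eq: "(\<Sum>b\<in>insert j J. r b *\<^sub>R b) = r j *\<^sub>R j + (\<Sum>b\<in>J. r b *\<^sub>R b)"
          "(\<Sum>b\<in>insert j J. r b * q b w) = r j * q j w + (\<Sum>b\<in>J. r b * q b w)"
        by (rule sum.insert[OF insert(1,2)])+
      from insert.prems have "j \<in> V" "J \<subseteq> V" by simp_all
      note IH = insert.IH[OF \<open>J \<subseteq> V\<close>]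
      show ?case unfolding eq
      proof
        show "r j *\<^sub>R j + (\<Sum>b\<in>J. r b *\<^sub>R b) \<in> V"
          by (rule subspace_add[OF V(1) subspace_scale[OF V(1) \<open>j \<in> V\<close>] conjunct1[OF IH]])
        show "q (r j *\<^sub>R j + (\<Sum>b\<in>J. r b *\<^sub>R b)) w = r j * q j w + (\<Sum>b\<in>J. r b * q b w)"
          using lin[OF \<open>j \<in> V\<close> conjunct1[OF IH] that(3), of "r j" 1]
          unfolding conjunct2[OF IH] scaleR_one mult_1 .
      qed
    qed
    \<comment> \<open>The orthogonal projection of \<open>c\<close> onto the span of the vectors found so far.\<close>
    define p where "p = (\<Sum>b\<in>B. q c b *\<^sub>R b)"
    define c' where "c' = c - p"
    have p: "p \<in> V" "p \<in> span B"
      using q_sum[OF B(1,2) c] unfolding p_def by (auto intro: span_sum span_scale span_base)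
    have c': "c' \<in> V" using c p V(1) by (simp add: c'_def subspace_diff)
    have orth: "q c' b = 0" if b: "b \<in> B" for b
    proof -
      have "q c' b = q c b - q p b"
        using lin[OF c p(1), of b 1 "-1"] b B(2) by (auto simp: c'_def)
      also have "q p b = (\<Sum>d\<in>B. q c d * q d b)"
        unfolding p_def using q_sum[OF B(1,2)] b B(2) by blast
      also have "\<dots> = (\<Sum>d\<in>B. if d = b then q c d else 0)"
        using on b by (intro sum.cong) auto
      also have "\<dots> = q c b" using b B(1) by simp
      finally show ?thesis by simp
    qed
    show ?case
    proof (cases "c' = 0")
      case True
      then have "c \<in> span B" using p by (simp add: c'_def)
      then show ?thesis using B on by (intro exI[of _ B]) auto
    next
      case False
      define r where "r = sqrt (q c' c')"
      define e where "e = (1 / r) *\<^sub>R c'"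
      have r: "r > 0" "r * r = q c' c'" using pos[OF c' False] by (auto simp: r_def)
      have e: "e \<in> V" using c' V(1) by (simp add: e_def subspace_scale)
      have qe: "q e w = q c' w / r" if "w \<in> V" for w
        using lin[OF c' subspace_0[OF V(1)] that, of "1 / r" 0] by (simp add: e_def)
      have "q e e = q c' c' / (r * r)" using qe[OF e] qe[OF c'] sym[OF c' e] by simp
      then have "q e e = 1" using r pos[OF c' False] by simp
      moreover have qb: "q e b = 0" "q b e = 0" if "b \<in> B" for b
        using qe[of b] orth[OF that] sym[OF _ e, of b] that B(2) by auto
      moreover have "e \<notin> B" using qb(1)[of e] \<open>q e e = 1\<close> by auto
      moreover have "c \<in> span (insert e B)"
      proof -
        have "c = r *\<^sub>R e + p" using r by (simp add: e_def c'_def)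
        moreover have "p \<in> span (insert e B)" using p(2) span_mono[of B "insert e B"] by blast
        ultimately show ?thesis by (simp add: span_add span_scale span_base)
      qed
      moreover have "C \<subseteq> span (insert e B)" using B(3) span_mono[of B "insert e B"] by blast
      ultimately show ?thesis
        using B(1,2) e on by (intro exI[of _ "insert e B"]) auto
    qed
  qed
  then obtain B where B: "finite B" "B \<subseteq> V" "C \<subseteq> span B"
      "\<forall>u\<in>B. \<forall>w\<in>B. q u w = (if u = w then 1 else 0)" by blast
  have "V \<subseteq> span B" using C(3) B(3) span_minimal[OF B(3) subspace_span] by blast
  then show ?thesis using B unfolding orthonormal_basis_def by blast
qed

section \<open>The distribution tangent to a foliation\<close>

lemma foliated_chart_compatible:
  assumes "smooth_atlas A" "smooth_atlas (A \<union> \<F>)" "(U, \<phi>) \<in> \<F>"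
  shows "compatible_chart A U \<phi>"
proof
  have U: "(\<Union>(U, \<phi>)\<in>A. U) = UNIV" using assms(1) by (simp add: smooth_atlas_def)
  show "smooth_atlas (insert (U, \<phi>) A)"
    unfolding smooth_atlas_def
  proof (intro conjI)
    show "\<forall>c\<in>insert (U, \<phi>) A. is_chart c" using assms(2,3) unfolding smooth_atlas_def by blast
    show "(\<Union>(U, \<phi>)\<in>insert (U, \<phi>) A. U) = UNIV" using U by auto
    show "\<forall>(W, \<psi>)\<in>insert (U, \<phi>) A. \<forall>(V, \<theta>)\<in>insert (U, \<phi>) A. smooth_on (\<psi> ` (W \<inter> V)) (\<theta> \<circ> inv_into W \<psi>)"
      by (intro ballI, simp only: split_paired_all prod.case, intro ballI, simp only: split_paired_all prod.case,
          rule smooth_atlasD(2)[OF assms(2)]) (use assms(3) in auto)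
  qed
qed (rule assms(1))

lemma tangent_distributionD:
  assumes "v \<in> tangent_distribution A \<F> x"
  shows "v \<in> tangent_space A x"
    and "(V, \<phi>) \<in> \<F> \<Longrightarrow> x \<in> V \<Longrightarrow> v (\<lambda>y. snd (\<phi> y) $ j) = 0"
  using assms unfolding tangent_distribution_def by blast+

lemma subspace_tangent_distribution: "subspace (tangent_distribution A \<F> x)"
proof -
  have "tangent_distribution A \<F> x =
      tangent_space A x \<inter> {v. \<forall>(U, \<phi>)\<in>\<F>. x \<in> U \<longrightarrow> (\<forall>j. v (\<lambda>y. snd (\<phi> y) $ j) = 0)}"
    by (auto simp: tangent_distribution_def)
  also have "subspace \<dots>"
    by (intro subspace_inter subspace_tangent_space) (auto simp: subspace_def scaleR_fun_def case_prod_unfold)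
  finally show ?thesis .
qed

lemma foliated_atlas_plaques:
  assumes "foliated_atlas A \<F>" "(U, \<phi>) \<in> \<F>" "(V, \<theta>) \<in> \<F>" "x \<in> U \<inter> V"
  shows "\<exists>W. open W \<and> x \<in> W \<and> W \<subseteq> U \<inter> V \<and>
    (\<forall>y\<in>W. \<forall>z\<in>W. snd (\<phi> y) = snd (\<phi> z) \<longrightarrow> snd (\<theta> y) = snd (\<theta> z))"
proof -
  have "\<forall>(U, \<phi>)\<in>\<F>. \<forall>(V, \<theta>)\<in>\<F>. \<forall>x \<in> U \<inter> V. \<exists>W. open W \<and> x \<in> W \<and> W \<subseteq> U \<inter> V \<and>
      (\<forall>y\<in>W. \<forall>z\<in>W. snd (\<phi> y) = snd (\<phi> z) \<longrightarrow> snd (\<theta> y) = snd (\<theta> z))"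
    using assms(1) unfolding foliated_atlas_def by (elim conjE)
  from bspec[OF bspec[OF this assms(2), unfolded prod.case] assms(3), unfolded prod.case]
  show ?thesis using assms(4) by (rule bspec)
qed

text \<open>A line with direction \<open>w\<close>, \<open>snd w = 0\<close>, stays in a plaque near its base
  point. Transverse coordinates of every foliated chart are locally constant on plaques, hence have zero
  derivative in the direction \<open>w\<close>.\<close>

lemma coord_field_tangent_distribution:
  assumes A: "smooth_atlas A" and F: "foliated_atlas A \<F>" and U: "(U, \<phi>) \<in> \<F>" "y \<in> U"
    and w: "snd w = 0"
  shows "compatible_chart.coord_field A U \<phi> w y \<in> tangent_distribution A \<F> y"
proof -
  interpret compatible_chart A U \<phi>
    using foliated_chart_compatible[OF A _ U(1)] F unfolding foliated_atlas_def by blast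
  have "coord_field w y (\<lambda>z. snd (\<theta> z) $ j) = 0" if V: "(V, \<theta>) \<in> \<F>" "y \<in> V" for V \<theta> j
  proof (cases "smooth_near A y (\<lambda>z. snd (\<theta> z) $ j)")
    case True
    define h where "h = (\<lambda>z. snd (\<theta> z) $ j) \<circ> inv_into U \<phi>"
    have "\<exists>W. open W \<and> y \<in> W \<and> W \<subseteq> U \<inter> V \<and>
      (\<forall>y\<in>W. \<forall>z\<in>W. snd (\<phi> y) = snd (\<phi> z) \<longrightarrow> snd (\<theta> y) = snd (\<theta> z))"
      by (rule foliated_atlas_plaques[OF F U(1) V(1)]) (use U V in simp)
    then obtain W where W: "open W" "y \<in> W" "W \<subseteq> U \<inter> V"
        and plaque: "\<And>y z. y \<in> W \<Longrightarrow> z \<in> W \<Longrightarrow> snd (\<phi> y) = snd (\<phi> z) \<Longrightarrow> snd (\<theta> y) = snd (\<theta> z)"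
      by blast
    have W': "open (\<phi> ` W)" using W by (intro is_chart_open_image[OF chart]) auto
    define T where "T = (\<lambda>r::real. \<phi> y + r *\<^sub>R w) -` (\<phi> ` W)"
    have T: "open T" "0 \<in> T"
      unfolding T_def using W' W(2) by (auto intro!: open_vimage continuous_intros)
    have const: "h (\<phi> y + r *\<^sub>R w) = h (\<phi> y + 0 *\<^sub>R w)" if "r \<in> T" for r
    proof -
      obtain z where z: "z \<in> W" "\<phi> y + r *\<^sub>R w = \<phi> z" using \<open>r \<in> T\<close> by (auto simp: T_def)
      have "snd (\<phi> z) = snd (\<phi> y)" using z(2)[symmetric] w by simp
      then have "snd (\<theta> z) = snd (\<theta> y)" using plaque z(1) W(2) by blast
      moreover have "inv_into U \<phi> (\<phi> z) = z" "inv_into U \<phi> (\<phi> y) = y"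
        using z(1) W U(2) chartD(3) by auto
      ultimately show ?thesis by (simp add: h_def z(2))
    qed
    have "((\<lambda>r. h (\<phi> y + r *\<^sub>R w)) has_derivative (\<lambda>r. coord_field (r *\<^sub>R w) y (\<lambda>z. snd (\<theta> z) $ j))) (at 0)"
      by (rule has_derivative_compose[of "\<lambda>r. \<phi> y + r *\<^sub>R w" _ 0 UNIV h])
        (use has_derivative_chart[OF U(2) True] in \<open>auto simp: h_def intro!: derivative_eq_intros\<close>)
    then have "((\<lambda>r. h (\<phi> y + 0 *\<^sub>R w)) has_derivative (\<lambda>r. coord_field (r *\<^sub>R w) y (\<lambda>z. snd (\<theta> z) $ j))) (at (0::real))"
      by (rule has_derivative_transform_within_open[OF _ T]) (rule const)
    then have "(\<lambda>r::real. coord_field (r *\<^sub>R w) y (\<lambda>z. snd (\<theta> z) $ j)) = (\<lambda>r. 0)"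
      by (rule has_derivative_unique) (rule has_derivative_const)
    then show ?thesis by (metis scaleR_one)
  qed (simp add: coord_field_def)
  then show ?thesis
    using coord_field_tangent[OF U(2)] by (auto simp: tangent_distribution_def)
qed

text \<open>A vector tangent to the plaque has no transverse coefficients in a foliated chart, so the field
  with the same constant coefficients is tangent to all plaques nearby.\<close>

lemma tangent_distribution_local_section:
  assumes A: "smooth_atlas A" and F: "foliated_atlas A \<F>" and v: "v \<in> tangent_distribution A \<F> x"
  shows "\<exists>X U. X x = v \<and> open U \<and> x \<in> U \<and> section_on A (tangent_distribution A \<F>) U X"
proof -
  have "x \<in> (\<Union>(U, \<phi>)\<in>\<F>. U)" using F by (simp add: foliated_atlas_def)
  then obtain U \<phi> where U: "(U, \<phi>) \<in> \<F>" "x \<in> U" by blast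
  interpret compatible_chart A U \<phi>
    using foliated_chart_compatible[OF A _ U(1)] F unfolding foliated_atlas_def by blast
  have vT: "v \<in> tangent_space A x" using v by (simp add: tangent_distribution_def)
  define w where "w = (\<Sum>b\<in>Basis. v (\<lambda>y. (\<phi> y - \<phi> x) \<bullet> b) *\<^sub>R b)"
  have "snd w $ j = 0" for j
  proof -
    have b: "(0, axis j 1) \<in> (Basis :: ((real^'b) \<times> (real^'c)) set)"
      by (simp add: Basis_prod_def axis_in_Basis_iff)
    have "snd w $ j = w \<bullet> (0, axis j 1)" by (simp add: inner_prod_def inner_axis)
    also have "\<dots> = v (\<lambda>y. (\<phi> y - \<phi> x) \<bullet> (0, axis j 1))"
      unfolding w_def using b by (simp add: inner_sum_left_Basis)
    also have "\<dots> = v (\<lambda>y. \<phi> y \<bullet> (0, axis j 1))" by (rule tangent_chart_component[OF U(2) vT])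
    also have "\<dots> = v (\<lambda>y. snd (\<phi> y) $ j)" by (simp add: inner_prod_def inner_axis)
    also have "\<dots> = 0" using v U by (auto simp: tangent_distribution_def)
    finally show ?thesis .
  qed
  then have "snd w = 0" by (simp add: vec_eq_iff)
  then have "section_on A (tangent_distribution A \<F>) U (coord_field w)"
    unfolding section_on_def using vector_field_coord_field coord_field_tangent_distribution[OF A F U(1)] by blast
  moreover have "coord_field w x = v" using tangent_eq_coord_field[OF U(2) vT] by (simp add: w_def)
  ultimately show ?thesis using U(2) chartD(1) by blast
qed

lemma tangent_distribution_finite_span:
  assumes A: "smooth_atlas A" and F: "foliated_atlas A \<F>"
  shows "\<exists>B. finite B \<and> tangent_distribution A \<F> x \<subseteq> span B"
proof -
  have "x \<in> (\<Union>(U, \<phi>)\<in>\<F>. U)" using F by (simp add: foliated_atlas_def)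
  then obtain U \<phi> where U: "(U, \<phi>) \<in> \<F>" "x \<in> U" by blast
  interpret compatible_chart A U \<phi>
    using foliated_chart_compatible[OF A _ U(1)] F unfolding foliated_atlas_def by blast
  show ?thesis
    using tangent_space_finite_span[OF U(2)] finite_imageI[OF finite_Basis] tangent_distributionD(1)
    by blast
qed

text \<open>For \<open>X\<close>, \<open>Y\<close> tangent to the plaques and \<open>f\<close> a transverse
  coordinate, \<open>X f\<close> and \<open>Y f\<close> vanish near \<open>x\<close>, hence so does \<open>X
  (Y f) - Y (X f)\<close> at \<open>x\<close>. That the bracket is a tangent vector at all is left as a
  hypothesis: it follows at once from a torsion-free connection (\<open>levi_civita_bracket_tangent\<close>),
  which is at hand wherever the lemma is applied.\<close>

lemma tangent_distribution_involutive:
  assumes A: "smooth_atlas A" and F: "foliated_atlas A \<F>"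
    and "open U" "x \<in> U" "section_on A (tangent_distribution A \<F>) U X" "section_on A (tangent_distribution A \<F>) U Y"
    and br: "lie_bracket A X Y x \<in> tangent_space A x"
  shows "lie_bracket A X Y x \<in> tangent_distribution A \<F> x"
proof -
  have "lie_bracket A X Y x (\<lambda>y. snd (\<phi> y) $ j) = 0" if V: "(V, \<phi>) \<in> \<F>" "x \<in> V" for V \<phi> j
  proof -
    have "open V" using F V is_chartD(1)[OF smooth_atlasD(1)[of "A \<union> \<F>"]] by (auto simp: foliated_atlas_def)
    then have ev: "eventually (\<lambda>y. y \<in> U \<and> y \<in> V) (nhds x)"
      using assms(3,4) V(2) by (auto simp: eventually_conj_iff eventually_nhds_in_open)
    have vanish: "eventually (\<lambda>y. Z y (\<lambda>y. snd (\<phi> y) $ j) = 0) (nhds x)"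
      if "section_on A (tangent_distribution A \<F>) U Z" for Z
      by (rule eventually_mono[OF ev])
        (use that V(1) tangent_distributionD(2) in \<open>unfold section_on_def, blast\<close>)
    have T: "X x \<in> tangent_space A x" "Y x \<in> tangent_space A x"
      using assms(4-6) by (auto simp: section_on_def tangent_distribution_def)
    then show ?thesis
      using tangent_locally_const[OF A T(1) vanish[OF assms(6)]] tangent_locally_const[OF A T(2) vanish[OF assms(5)]]
      unfolding lie_bracket_def by simp
  qed
  then show ?thesis using br by (auto simp: tangent_distribution_def)
qed

section \<open>Riemannian metrics and the Koszul formula\<close>

lemma riemannian_metricD:
  assumes "riemannian_metric A g"
  shows "u \<in> tangent_space A x \<Longrightarrow> v \<in> tangent_space A x \<Longrightarrow> w \<in> tangent_space A x \<Longrightarrow>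
      g x (a *\<^sub>R u + b *\<^sub>R v) w = a * g x u w + b * g x v w"
    "u \<in> tangent_space A x \<Longrightarrow> v \<in> tangent_space A x \<Longrightarrow> g x u v = g x v u"
    "v \<in> tangent_space A x \<Longrightarrow> v \<noteq> 0 \<Longrightarrow> g x v v > 0"
    "open U \<Longrightarrow> vector_field_on A U X \<Longrightarrow> vector_field_on A U Y \<Longrightarrow>
      smooth_fun_on A U (\<lambda>x. g x (X x) (Y x))"
proof -
  note c = assms[unfolded riemannian_metric_def]
  show "u \<in> tangent_space A x \<Longrightarrow> v \<in> tangent_space A x \<Longrightarrow> w \<in> tangent_space A x \<Longrightarrow>
      g x (a *\<^sub>R u + b *\<^sub>R v) w = a * g x u w + b * g x v w"
    using conjunct1[OF c] by simp
  show "u \<in> tangent_space A x \<Longrightarrow> v \<in> tangent_space A x \<Longrightarrow> g x u v = g x v u"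
    using conjunct1[OF conjunct2[OF c]] by blast
  show "v \<in> tangent_space A x \<Longrightarrow> v \<noteq> 0 \<Longrightarrow> g x v v > 0"
    using conjunct1[OF conjunct2[OF conjunct2[OF c]]] by simp
  show "open U \<Longrightarrow> vector_field_on A U X \<Longrightarrow> vector_field_on A U Y \<Longrightarrow>
      smooth_fun_on A U (\<lambda>x. g x (X x) (Y x))"
    using conjunct2[OF conjunct2[OF conjunct2[OF c]]] by simp
qed

lemma metric_linear_left:
  assumes "riemannian_metric A g"
    and "u \<in> tangent_space A x" "v \<in> tangent_space A x" "w \<in> tangent_space A x"
  shows "g x (u + v) w = g x u w + g x v w" "g x (u - v) w = g x u w - g x v w"
    "g x (c *\<^sub>R u) w = c * g x u w" "g x 0 w = 0"
  using riemannian_metricD(1)[OF assms, of 1 1] riemannian_metricD(1)[OF assms, of 1 "-1"]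
    riemannian_metricD(1)[OF assms, of c 0] riemannian_metricD(1)[OF assms, of 0 0] by simp_all

lemma metric_linear_right:
  assumes g: "riemannian_metric A g"
    and T: "u \<in> tangent_space A x" "v \<in> tangent_space A x" "w \<in> tangent_space A x"
  shows "g x w (u + v) = g x w u + g x w v" "g x w (u - v) = g x w u - g x w v"
    "g x w (c *\<^sub>R u) = c * g x w u" "g x w 0 = 0"
proof -
  note S = subspace_tangent_space[of A x]
  note sym = riemannian_metricD(2)[OF g T(3)]
  show "g x w (u + v) = g x w u + g x w v" "g x w (u - v) = g x w u - g x w v"
    "g x w (c *\<^sub>R u) = c * g x w u" "g x w 0 = 0"
    using metric_linear_left(1,2,4)[OF g T] metric_linear_left(3)[OF g T, of c] sym[OF subspace_add[OF S T(1,2)]] sym[OF subspace_diff[OF S T(1,2)]]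
      sym[OF subspace_scale[OF S T(1)], of c] sym[OF subspace_0[OF S]] sym[OF T(1)] sym[OF T(2)]
    by simp_all
qed

lemma vector_field_onD: "vector_field_on A U X \<Longrightarrow> x \<in> U \<Longrightarrow> X x \<in> tangent_space A x"
  unfolding vector_field_on_def by blast

lemma vector_field_on_subset: "vector_field_on A U X \<Longrightarrow> W \<subseteq> U \<Longrightarrow> vector_field_on A W X"
  unfolding vector_field_on_def by (meson order_trans subsetD)

lemma levi_civitaD:
  assumes "levi_civita A g nabla" "open U" "x \<in> U" "vector_field_on A U X" "vector_field_on A U Y"
  shows "v \<in> tangent_space A x \<Longrightarrow> nabla x v Y \<in> tangent_space A x"
    and "nabla x (X x) Y - nabla x (Y x) X = lie_bracket A X Y x"
    and "v \<in> tangent_space A x \<Longrightarrow>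
      v (\<lambda>y. g y (X y) (Y y)) = g x (nabla x v X) (Y x) + g x (X x) (nabla x v Y)"
proof -
  note c = assms(1)[unfolded levi_civita_def]
  show "nabla x v Y \<in> tangent_space A x" if "v \<in> tangent_space A x"
    using conjunct1[OF conjunct1[OF c, unfolded affine_connection_def]] that assms(2-5) by blast
  show "nabla x (X x) Y - nabla x (Y x) X = lie_bracket A X Y x"
    using conjunct1[OF conjunct2[OF c]] assms(2-5) by blast
  show "v (\<lambda>y. g y (X y) (Y y)) = g x (nabla x v X) (Y x) + g x (X x) (nabla x v Y)"
    if "v \<in> tangent_space A x"
    using conjunct2[OF conjunct2[OF c]] that assms(2-5) by blast
qed

lemma levi_civita_bracket_tangent:
  assumes "levi_civita A g nabla" "open U" "x \<in> U" "vector_field_on A U X" "vector_field_on A U Y"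
  shows "lie_bracket A X Y x \<in> tangent_space A x"
  unfolding levi_civitaD(2)[OF assms, symmetric]
  by (intro subspace_diff[OF subspace_tangent_space] levi_civitaD(1)[OF assms] levi_civitaD(1)[OF assms(1-3,5,4)]
      vector_field_onD[OF assms(4,3)] vector_field_onD[OF assms(5,3)])

text \<open>Koszul's formula when \<open>Z\<close> is orthogonal to \<open>X\<close>, \<open>Y\<close> and
  \<open>[X, Y]\<close>: differentiate \<open>g(Y, Z) = 0\<close> along \<open>X\<close> and \<open>g(X, Z) =
  0\<close> along \<open>Y\<close>, trade \<open>\<nabla>\<^sub>X Z\<close> for \<open>[X, Z] +
  \<nabla>\<^sub>Z X\<close> and likewise for \<open>Y\<close>, and use that \<open>\<nabla>\<^sub>X Y\<close>
  and \<open>\<nabla>\<^sub>Y X\<close> differ by \<open>[X, Y]\<close>.\<close>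

lemma koszul_orthogonal:
  assumes A: "smooth_atlas A" and g: "riemannian_metric A g" and L: "levi_civita A g nabla"
    and U: "open U" "x \<in> U" and X: "vector_field_on A U X" and Y: "vector_field_on A U Y"
    and Z: "vector_field_on A U Z"
    and XZ: "\<And>y. y \<in> U \<Longrightarrow> g y (X y) (Z y) = 0" and YZ: "\<And>y. y \<in> U \<Longrightarrow> g y (Y y) (Z y) = 0"
    and br: "g x (lie_bracket A X Y x) (Z x) = 0"
  shows "2 * g x (nabla x (X x) Y) (Z x) =
    - g x (Y x) (lie_bracket A X Z x) - g x (X x) (lie_bracket A Y Z x) - Z x (\<lambda>y. g y (X y) (Y y))"
proof -
  note T = X[THEN vector_field_onD, OF U(2)] Y[THEN vector_field_onD, OF U(2)] Z[THEN vector_field_onD, OF U(2)]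
  note nT = levi_civitaD(1)[OF L U X Y T(1)] levi_civitaD(1)[OF L U Y X T(2)]
    levi_civitaD(1)[OF L U X Z T(1)] levi_civitaD(1)[OF L U Y Z T(2)]
    levi_civitaD(1)[OF L U Z X T(3)] levi_civitaD(1)[OF L U Z Y T(3)]
  have ev: "eventually (\<lambda>y. y \<in> U) (nhds x)" using U by (rule eventually_nhds_in_open)
  have "g x (nabla x (X x) Y) (Z x) + g x (Y x) (nabla x (X x) Z) = 0"
    unfolding levi_civitaD(3)[OF L U Y Z T(1), symmetric]
    by (rule tangent_locally_const[OF A T(1) eventually_mono[OF ev YZ]])
  moreover have "g x (nabla x (Y x) X) (Z x) + g x (X x) (nabla x (Y x) Z) = 0"
    unfolding levi_civitaD(3)[OF L U X Z T(2), symmetric]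
    by (rule tangent_locally_const[OF A T(2) eventually_mono[OF ev XZ]])
  moreover have "g x (Y x) (nabla x (X x) Z) - g x (Y x) (nabla x (Z x) X) = g x (Y x) (lie_bracket A X Z x)"
    unfolding levi_civitaD(2)[OF L U X Z, symmetric] metric_linear_right(2)[OF g nT(3,5) T(2)] ..
  moreover have "g x (X x) (nabla x (Y x) Z) - g x (X x) (nabla x (Z x) Y) = g x (X x) (lie_bracket A Y Z x)"
    unfolding levi_civitaD(2)[OF L U Y Z, symmetric] metric_linear_right(2)[OF g nT(4,6) T(1)] ..
  moreover have "g x (nabla x (X x) Y) (Z x) - g x (nabla x (Y x) X) (Z x) = 0"
    unfolding metric_linear_left(2)[OF g nT(1,2) T(3), symmetric] levi_civitaD(2)[OF L U X Y] by (rule br)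
  moreover have "Z x (\<lambda>y. g y (X y) (Y y)) = g x (nabla x (Z x) X) (Y x) + g x (X x) (nabla x (Z x) Y)"
    by (rule levi_civitaD(3)[OF L U X Y T(3)])
  moreover have "g x (nabla x (Z x) X) (Y x) = g x (Y x) (nabla x (Z x) X)"
    by (rule riemannian_metricD(2)[OF g nT(5) T(2)])
  ultimately show ?thesis by linarith
qed

section \<open>Metrics varying conformally in the transverse directions\<close>

text \<open>Here \<open>c \<tau> = c t / E \<tau>\<close>, and \<open>1 / E\<close> has derivative \<open>-
  s\<close> at \<open>t\<close> because \<open>E t = 1\<close>.\<close>

lemma has_tvec_derivative_rescaled:
  assumes "open I" "t \<in> I" "\<And>\<tau>. \<tau> \<in> I \<Longrightarrow> E \<tau> > 0" "E t = 1"
    and E: "(E has_real_derivative s) (at t)" and c: "\<And>\<tau>. \<tau> \<in> I \<Longrightarrow> c t = E \<tau> *\<^sub>R c \<tau>"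
  shows "has_tvec_derivative c ((- s) *\<^sub>R c t) t"
  unfolding has_tvec_derivative_def
proof
  fix f
  have "((\<lambda>\<tau>. c t f / E \<tau>) has_real_derivative - s * c t f) (at t)"
    using assms(4) by (auto intro!: derivative_eq_intros E)
  then have "((\<lambda>\<tau>. c \<tau> f) has_real_derivative - s * c t f) (at t)"
  proof (rule has_field_derivative_transform_within_open[OF _ assms(1,2)])
    fix \<tau> assume \<tau>: "\<tau> \<in> I"
    have "c t f = E \<tau> * c \<tau> f" by (subst c[OF \<tau>]) (simp add: scaleR_fun_def)
    then show "c t f / E \<tau> = c \<tau> f" using assms(3)[OF \<tau>] by simp
  qed
  then show "((\<lambda>\<tau>. c \<tau> f) has_real_derivative ((- s) *\<^sub>R c t) f) (at t)"
    by (simp add: scaleR_fun_def)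
qed

text \<open>The setting of the theorem, with the foliation reduced to an involutive distribution
  \<open>D'\<close>.\<close>

locale transverse_conformal_variation =
  fixes A :: "('a::topological_space, 'e::euclidean_space) chart set"
    and D D' :: "'a \<Rightarrow> 'a tvec set" and k :: nat
    and I :: "real set" and g :: "real \<Rightarrow> 'a metric" and nabla :: "real \<Rightarrow> 'a connection"
    and s :: "real \<Rightarrow> 'a \<Rightarrow> real"
  assumes A: "smooth_atlas A" and D: "smooth_distribution A k D"
    and D': "\<And>x. subspace (D' x)" "\<And>x. D' x \<subseteq> tangent_space A x"
    and compl: "complementary A D D'"
    and involutive: "\<And>U X Y x. open U \<Longrightarrow> x \<in> U \<Longrightarrow> section_on A D' U X \<Longrightarrow> section_on A D' U Y \<Longrightarrow>
      lie_bracket A X Y x \<in> tangent_space A x \<Longrightarrow> lie_bracket A X Y x \<in> D' x"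
    and I: "is_interval I"
    and metric: "\<And>t. t \<in> I \<Longrightarrow> riemannian_metric A (g t)"
    and adapted: "\<And>t. t \<in> I \<Longrightarrow> adapted D D' (g t)"
    and LC: "\<And>t. t \<in> I \<Longrightarrow> levi_civita A (g t) (nabla t)"
    and variation: "\<And>t x v w. t \<in> I \<Longrightarrow> v \<in> tangent_space A x \<Longrightarrow> w \<in> tangent_space A x \<Longrightarrow>
      ((\<lambda>\<tau>. g \<tau> x v w) has_real_derivative s t x * perp_metric D D' (g t) x v w) (at t)"
begin

lemma D_tangent: "D x \<subseteq> tangent_space A x"
  using D unfolding smooth_distribution_def by blast

lemma local_frame:
  obtains W E where "open W" "x \<in> W" "\<forall>i<k. vector_field_on A W (E i)"
    "\<forall>y\<in>W. D y = span ((\<lambda>i. E i y) ` {..<k})"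
proof -
  obtain W E where "open W" "x \<in> W" "\<forall>i<k. vector_field_on A W (E i)"
    and E: "\<forall>y\<in>W. inj_on (\<lambda>i. E i y) {..<k} \<and> independent ((\<lambda>i. E i y) ` {..<k}) \<and>
        D y = span ((\<lambda>i. E i y) ` {..<k})"
    using spec[OF conjunct2[OF D[unfolded smooth_distribution_def]], of x] by (elim exE conjE)
  show thesis
  proof (rule that[OF \<open>open W\<close> \<open>x \<in> W\<close> \<open>\<forall>i<k. vector_field_on A W (E i)\<close>], rule ballI)
    show "D y = span ((\<lambda>i. E i y) ` {..<k})" if "y \<in> W" for y
      using bspec[OF E that] by (elim conjE)
  qed
qed

lemma subspace_D: "subspace (D x)"
  by (rule local_frame[of x]) (simp only: subspace_span)

lemma D_Int_D': "u \<in> D x \<Longrightarrow> u \<in> D' x \<Longrightarrow> u = 0"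
  using spec[OF compl[unfolded complementary_def], THEN conjunct1, of x] by blast

lemma proj_unique: "u \<in> D x \<Longrightarrow> v - u \<in> D' x \<Longrightarrow> proj_along D D' x v = u"
  unfolding proj_along_def
proof (rule the_equality)
  fix u' assume u: "u \<in> D x" "v - u \<in> D' x" and u': "u' \<in> D x \<and> v - u' \<in> D' x"
  have "u' - u = (v - u) - (v - u')" by simp
  then have "u' - u \<in> D' x" using u u' subspace_diff[OF D'(1)] by metis
  then have "u' - u = 0" using u u' subspace_diff[OF subspace_D] by (intro D_Int_D') blast+
  then show "u' = u" by simp
qed simp

lemma proj:
  assumes "v \<in> tangent_space A x"
  shows "proj_along D D' x v \<in> D x" "v - proj_along D D' x v \<in> D' x"
proof -
  have "v \<in> {u + w | u w. u \<in> D x \<and> w \<in> D' x}"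
    using assms unfolding spec[OF compl[unfolded complementary_def], THEN conjunct2, of x] .
  then obtain u w where uw: "v = u + w" "u \<in> D x" "w \<in> D' x" by blast
  then have "proj_along D D' x v = u" by (intro proj_unique) simp_all
  then show "proj_along D D' x v \<in> D x" "v - proj_along D D' x v \<in> D' x" using uw by simp_all
qed

lemma proj_D: "u \<in> D x \<Longrightarrow> proj_along D D' x u = u"
  by (rule proj_unique) (simp_all add: subspace_0[OF D'(1)])

lemma proj_D': "u \<in> D' x \<Longrightarrow> proj_along D D' x u = 0"
  by (rule proj_unique) (simp_all add: subspace_0[OF subspace_D])

lemma constant_on_I:
  assumes "\<And>\<tau>. \<tau> \<in> I \<Longrightarrow> (f has_real_derivative 0) (at \<tau>)" "t \<in> I" "t' \<in> I"
  shows "f t = f t'"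
proof -
  have "convex I" using I by (simp add: is_interval_convex)
  then obtain c where "\<forall>x\<in>I. f x = c"
    using has_field_derivative_zero_constant[of I f] has_field_derivative_at_within[OF assms(1)] by blast
  then show ?thesis using assms by simp
qed

text \<open>The right-hand side of the evolution equation vanishes because \<open>u\<close> projects to zero
  in \<open>D\<close>. It is essential that only one argument has to be tangent to the leaves: in Koszul's
  formula the other one is a bracket.\<close>

lemma metric_leafwise_constant:
  assumes "u \<in> D' x" "w \<in> tangent_space A x" "t \<in> I" "t' \<in> I"
  shows "g t x u w = g t' x u w"
proof (rule constant_on_I[OF _ assms(3,4)])
  fix \<tau> assume \<tau>: "\<tau> \<in> I"
  have pw: "proj_along D D' x w \<in> tangent_space A x" using proj(1)[OF assms(2)] D_tangent by blast
  have "perp_metric D D' (g \<tau>) x u w = 0"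
    unfolding perp_metric_def proj_D'[OF assms(1)]
    by (rule metric_linear_left(4)[OF metric[OF \<tau>] pw pw pw])
  moreover have "u \<in> tangent_space A x" using assms(1) D'(2) by blast
  ultimately show "((\<lambda>\<tau>. g \<tau> x u w) has_real_derivative 0) (at \<tau>)"
    using variation[OF \<tau> _ assms(2), of u] by simp
qed

lemma variation_D:
  assumes "t \<in> I" "u \<in> D x" "w \<in> D x"
  shows "((\<lambda>\<tau>. g \<tau> x u w) has_real_derivative s t x * g t x u w) (at t)"
  using variation[OF assms(1), of u x w] assms D_tangent unfolding perp_metric_def
  by (simp add: proj_D subset_iff)

text \<open>For a fixed nonzero \<open>u0\<close> in \<open>D x\<close>, both \<open>g \<tau> x u w\<close>
  and the positive function \<open>g \<tau> x u0 u0\<close> solve \<open>y' = s y\<close>, so their quotient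
  is constant. This gives \<open>E\<close> without integrating \<open>s\<close>.\<close>

lemma conformal_factor:
  assumes t: "t \<in> I"
  obtains E where "E t = 1" "\<And>\<tau>. \<tau> \<in> I \<Longrightarrow> E \<tau> > 0" "(E has_real_derivative s t x) (at t)"
    "\<And>\<tau> u w. \<tau> \<in> I \<Longrightarrow> u \<in> D x \<Longrightarrow> w \<in> D x \<Longrightarrow> g \<tau> x u w = E \<tau> * g t x u w"
proof (cases "D x \<subseteq> {0}")
  case True
  \<comment> \<open>On the zero space any positive function with the right value and derivative at \<open>t\<close> will do.\<close>
  define E where "E \<tau> = exp (s t x * (\<tau> - t))" for \<tau>
  have "(E has_real_derivative s t x) (at t)"
    unfolding E_def by (auto intro!: derivative_eq_intros)
  moreover have "g \<tau> x u w = E \<tau> * g t x u w" if "\<tau> \<in> I" "u \<in> D x" "w \<in> D x" for \<tau> u w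
  proof -
    have "u = 0" "w \<in> tangent_space A x" using that True D_tangent by auto
    then show ?thesis using metric_linear_left(4)[OF metric] that(1) t by (metis mult_zero_right)
  qed
  ultimately show ?thesis by (intro that[of E]) (auto simp: E_def)
next
  case False
  then obtain u0 where u0: "u0 \<in> D x" "u0 \<noteq> 0" by blast
  have pos: "g \<tau> x u0 u0 > 0" if "\<tau> \<in> I" for \<tau>
    using riemannian_metricD(3)[OF metric[OF that]] u0 D_tangent by blast
  define E where "E \<tau> = g \<tau> x u0 u0 / g t x u0 u0" for \<tau>
  show ?thesis
  proof (rule that[of E])
    show "E t = 1" "\<And>\<tau>. \<tau> \<in> I \<Longrightarrow> E \<tau> > 0" using pos t by (auto simp: E_def less_imp_neq[symmetric])
    have "(E has_real_derivative s t x * g t x u0 u0 / g t x u0 u0) (at t)"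
      unfolding E_def by (rule DERIV_cdivide[OF variation_D[OF t u0(1) u0(1)]])
    then show "(E has_real_derivative s t x) (at t)" using pos[OF t] by simp
    fix \<tau> u w assume \<tau>: "\<tau> \<in> I" and u: "u \<in> D x" and w: "w \<in> D x"
    have "g \<tau> x u w / g \<tau> x u0 u0 = g t x u w / g t x u0 u0"
    proof (rule constant_on_I[OF _ \<tau> t])
      fix \<sigma> assume \<sigma>: "\<sigma> \<in> I"
      have "((\<lambda>\<tau>. g \<tau> x u w / g \<tau> x u0 u0) has_real_derivative
        ((s \<sigma> x * g \<sigma> x u w) * g \<sigma> x u0 u0 - g \<sigma> x u w * (s \<sigma> x * g \<sigma> x u0 u0)) / (g \<sigma> x u0 u0 * g \<sigma> x u0 u0)) (at \<sigma>)"
        using pos[OF \<sigma>] by (intro DERIV_divide variation_D \<sigma> u w u0) simp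
      then show "((\<lambda>\<tau>. g \<tau> x u w / g \<tau> x u0 u0) has_real_derivative 0) (at \<sigma>)" by simp
    qed
    then show "g \<tau> x u w = E \<tau> * g t x u w"
      using pos[OF \<tau>] pos[OF t] by (simp add: E_def field_simps)
  qed
qed

text \<open>For \<open>z\<close> the value of a local section \<open>Z\<close> of \<open>D\<close>, every term
  on the right of the Koszul formula is constant in time. Local frames provide enough such sections, and both
  sides are linear in \<open>z\<close>.\<close>

lemma normal_component_constant:
  assumes t: "t \<in> I" "t' \<in> I" and U: "open U" "x \<in> U"
    and X: "section_on A D' U X" and Y: "section_on A D' U Y" and z: "z \<in> D x"
  shows "g t x (nabla t x (X x) Y) z = g t' x (nabla t' x (X x) Y) z"
proof -
  obtain W E where W: "open W" "x \<in> W" "\<forall>i<k. vector_field_on A W (E i)"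
      and E: "\<forall>y\<in>W. D y = span ((\<lambda>i. E i y) ` {..<k})"
    by (rule local_frame[of x])
  define N where "N = U \<inter> W"
  have N: "open N" "x \<in> N" "N \<subseteq> U" "N \<subseteq> W" using U W by (auto simp: N_def)
  have X': "section_on A D' N X" and Y': "section_on A D' N Y"
    using X Y N(3) vector_field_on_subset[OF _ N(3)] by (auto simp: section_on_def)
  then have XO: "vector_field_on A N X" and YO: "vector_field_on A N Y" by (auto simp: section_on_def)
  have XD: "X y \<in> D' y" and YD: "Y y \<in> D' y" if "y \<in> N" for y
    using X' Y' that by (auto simp: section_on_def)
  have frame: "g t x (nabla t x (X x) Y) (Z x) = g t' x (nabla t' x (X x) Y) (Z x)"
    if Z: "vector_field_on A N Z" and ZD: "\<And>y. y \<in> N \<Longrightarrow> Z y \<in> D y" for Z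
  proof -
    have orth: "g \<tau> y w (Z y) = 0" if "\<tau> \<in> I" "y \<in> N" "w \<in> D' y" for \<tau> y w
    proof -
      have "g \<tau> y (Z y) w = 0" using adapted[OF that(1)] ZD[OF that(2)] that(3) by (simp add: adapted_def)
      then show ?thesis
        using riemannian_metricD(2)[OF metric[OF that(1)], of w y "Z y"] that D'(2) vector_field_onD[OF Z that(2)]
        by auto
    qed
    have k: "2 * g \<tau> x (nabla \<tau> x (X x) Y) (Z x) =
      - g \<tau> x (Y x) (lie_bracket A X Z x) - g \<tau> x (X x) (lie_bracket A Y Z x) - Z x (\<lambda>y. g \<tau> y (X y) (Y y))"
      if \<tau>: "\<tau> \<in> I" for \<tau>
    proof (rule koszul_orthogonal[OF A metric[OF \<tau>] LC[OF \<tau>] N(1,2) XO YO Z])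
      show "g \<tau> y (X y) (Z y) = 0" "g \<tau> y (Y y) (Z y) = 0" if "y \<in> N" for y
        using orth[OF \<tau> that] XD YD that by auto
      show "g \<tau> x (lie_bracket A X Y x) (Z x) = 0"
        by (rule orth[OF \<tau> N(2) involutive[OF N(1,2) X' Y' levi_civita_bracket_tangent[OF LC[OF \<tau>] N(1,2) XO YO]]])
    qed
    have "g t x (Y x) (lie_bracket A X Z x) = g t' x (Y x) (lie_bracket A X Z x)"
      by (rule metric_leafwise_constant[OF YD[OF N(2)] levi_civita_bracket_tangent[OF LC[OF t(1)] N(1,2) XO Z] t])
    moreover have "g t x (X x) (lie_bracket A Y Z x) = g t' x (X x) (lie_bracket A Y Z x)"
      by (rule metric_leafwise_constant[OF XD[OF N(2)] levi_civita_bracket_tangent[OF LC[OF t(1)] N(1,2) YO Z] t])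
    moreover have "Z x (\<lambda>y. g t y (X y) (Y y)) = Z x (\<lambda>y. g t' y (X y) (Y y))"
    proof (rule tangent_spaceD(4)[OF vector_field_onD[OF Z N(2)]])
      show "smooth_near A x (\<lambda>y. g t y (X y) (Y y))" "smooth_near A x (\<lambda>y. g t' y (X y) (Y y))"
        using t by (auto intro!: smooth_nearI[OF N(1,2)] riemannian_metricD(4)[OF metric N(1) XO YO])
      show "eventually (\<lambda>y. g t y (X y) (Y y) = g t' y (X y) (Y y)) (nhds x)"
        by (rule eventually_mono[OF eventually_nhds_in_open[OF N(1,2)]])
          (rule metric_leafwise_constant[OF XD vector_field_onD[OF YO] t])
    qed
    ultimately show ?thesis using k[OF t(1)] k[OF t(2)] by simp
  qed
  \<comment> \<open>The vectors satisfying the claim form a subspace that contains a frame of \<open>D x\<close>.\<close>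
  define K where "K = {z \<in> tangent_space A x. g t x (nabla t x (X x) Y) z = g t' x (nabla t' x (X x) Y) z}"
  have nT: "nabla \<tau> x (X x) Y \<in> tangent_space A x" if "\<tau> \<in> I" for \<tau>
    by (rule levi_civitaD(1)[OF LC[OF that] N(1,2) XO YO vector_field_onD[OF XO N(2)]])
  note lin = metric_linear_right[OF metric[OF t(1)] _ _ nT[OF t(1)]] metric_linear_right[OF metric[OF t(2)] _ _ nT[OF t(2)]]
  have "subspace K"
  proof (rule subspaceI)
    note S = subspace_tangent_space[of A x]
    show "0 \<in> K" using lin(4)[of 0 0] lin(8)[of 0 0] subspace_0[OF S] by (simp add: K_def)
    show "u + v \<in> K" if "u \<in> K" "v \<in> K" for u v
      using that lin(1)[of u v] lin(5)[of u v] subspace_add[OF S, of u v] by (simp add: K_def)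
    show "c *\<^sub>R u \<in> K" if "u \<in> K" for c u
      using that lin(3)[of u u c] lin(7)[of u u c] subspace_scale[OF S, of u c] by (simp add: K_def)
  qed
  moreover have "(\<lambda>i. E i x) ` {..<k} \<subseteq> K"
  proof
    fix z assume "z \<in> (\<lambda>i. E i x) ` {..<k}"
    then obtain i where i: "i < k" "z = E i x" by blast
    have ZO: "vector_field_on A N (E i)" by (rule vector_field_on_subset[OF W(3)[rule_format, OF i(1)] N(4)])
    have ZD: "E i y \<in> D y" if "y \<in> N" for y
      using bspec[OF E, of y] that N(4) i(1) by (auto intro: span_base)
    show "z \<in> K"
      using frame[OF ZO ZD] vector_field_onD[OF ZO N(2)] by (simp add: K_def i(2))
  qed
  ultimately have "span ((\<lambda>i. E i x) ` {..<k}) \<subseteq> K" by (rule span_minimal[rotated])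
  then show ?thesis using z bspec[OF E W(2)] by (auto simp: K_def)
qed

text \<open>On \<open>D x\<close>, \<open>E \<tau> * g t x (h \<tau>) z = g \<tau> x (h \<tau>) z = g t x (h
  t) z\<close> for all \<open>z\<close>, by \<open>conformal_factor\<close> and
  \<open>normal_component_constant\<close>; nondegeneracy of \<open>g t x\<close> on \<open>D x\<close> yields
  the equation. The factor \<open>E\<close> depends on the point \<open>x\<close> but not on \<open>X\<close>
  and \<open>Y\<close>, which is what makes it pass through the trace.\<close>

lemma second_fundamental_form_rescaled:
  assumes t: "t \<in> I"
  obtains E where "E t = 1" "\<And>\<tau>. \<tau> \<in> I \<Longrightarrow> E \<tau> > 0" "(E has_real_derivative s t x) (at t)"
    "\<And>\<tau> U X Y. \<tau> \<in> I \<Longrightarrow> open U \<Longrightarrow> x \<in> U \<Longrightarrow> section_on A D' U X \<Longrightarrow> section_on A D' U Y \<Longrightarrow>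
      second_fundamental_form D D' (nabla t) X Y x = E \<tau> *\<^sub>R second_fundamental_form D D' (nabla \<tau>) X Y x"
proof -
  obtain E where E: "E t = 1" "\<And>\<tau>. \<tau> \<in> I \<Longrightarrow> E \<tau> > 0" "(E has_real_derivative s t x) (at t)"
    "\<And>\<tau> u w. \<tau> \<in> I \<Longrightarrow> u \<in> D x \<Longrightarrow> w \<in> D x \<Longrightarrow> g \<tau> x u w = E \<tau> * g t x u w"
    using conformal_factor[OF t, of x] by metis
  show thesis
  proof (rule that[OF E(1-3)])
    fix \<tau> U X Y assume \<tau>: "\<tau> \<in> I" and U: "open U" "x \<in> U"
      and X: "section_on A D' U X" and Y: "section_on A D' U Y"
    define h where "h \<sigma> = second_fundamental_form D D' (nabla \<sigma>) X Y x" for \<sigma>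
    have XU: "vector_field_on A U X" and YU: "vector_field_on A U Y" using X Y by (auto simp: section_on_def)
    have nT: "nabla \<sigma> x (X x) Y \<in> tangent_space A x" if "\<sigma> \<in> I" for \<sigma>
      by (rule levi_civitaD(1)[OF LC[OF that] U XU YU vector_field_onD[OF XU U(2)]])
    have hD: "h \<sigma> \<in> D x" if "\<sigma> \<in> I" for \<sigma>
      unfolding h_def second_fundamental_form_def by (rule proj(1)[OF nT[OF that]])
    have hT: "h \<sigma> \<in> tangent_space A x" if "\<sigma> \<in> I" for \<sigma> using hD[OF that] D_tangent by blast
    have gh: "g \<sigma> x (nabla \<sigma> x (X x) Y) z = g \<sigma> x (h \<sigma>) z" if \<sigma>: "\<sigma> \<in> I" and z: "z \<in> D x" for \<sigma> z
    proof -
      have zT: "z \<in> tangent_space A x" using z D_tangent by blast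
      have d: "nabla \<sigma> x (X x) Y - h \<sigma> \<in> D' x"
        unfolding h_def second_fundamental_form_def by (rule proj(2)[OF nT[OF \<sigma>]])
      then have "g \<sigma> x z (nabla \<sigma> x (X x) Y - h \<sigma>) = 0" using adapted[OF \<sigma>] z by (simp add: adapted_def)
      then show ?thesis
        using metric_linear_right(2)[OF metric[OF \<sigma>] nT[OF \<sigma>] hT[OF \<sigma>] zT]
          riemannian_metricD(2)[OF metric[OF \<sigma>] zT] nT[OF \<sigma>] hT[OF \<sigma>] by simp
    qed
    \<comment> \<open>The defect \<open>d\<close> lies in \<open>D x\<close> and is \<open>g t x\<close>-orthogonal to itself.\<close>
    define d where "d = h t - E \<tau> *\<^sub>R h \<tau>"
    have dD: "d \<in> D x"
      unfolding d_def by (intro subspace_diff subspace_scale subspace_D hD t \<tau>)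
    have dT: "d \<in> tangent_space A x" using dD D_tangent by blast
    have "g t x d d = g t x (h t) d - g t x (E \<tau> *\<^sub>R h \<tau>) d"
      unfolding d_def[THEN arg_cong, of "\<lambda>u. g t x u d"]
      by (rule metric_linear_left(2)[OF metric[OF t] hT[OF t] subspace_scale[OF subspace_tangent_space hT[OF \<tau>]] dT])
    also have "g t x (E \<tau> *\<^sub>R h \<tau>) d = E \<tau> * g t x (h \<tau>) d"
      by (rule metric_linear_left(3)[OF metric[OF t] hT[OF \<tau>] hT[OF \<tau>] dT])
    also have "\<dots> = g \<tau> x (h \<tau>) d" by (rule E(4)[OF \<tau> hD[OF \<tau>] dD, symmetric])
    also have "g \<tau> x (h \<tau>) d = g t x (h t) d"
      using normal_component_constant[OF \<tau> t U X Y dD] gh[OF \<tau> dD] gh[OF t dD] by simp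
    finally have "d = 0" using riemannian_metricD(3)[OF metric[OF t] dT] by fastforce
    then show "second_fundamental_form D D' (nabla t) X Y x = E \<tau> *\<^sub>R second_fundamental_form D D' (nabla \<tau>) X Y x"
      by (simp add: d_def h_def)
  qed
qed

section \<open>The mean curvature\<close>

text \<open>Orthonormality of leafwise vectors does not depend on time, so the choice of a basis in the
  definition of the mean curvature picks the same one at all times.\<close>

lemma orthonormal_basis_constant:
  assumes "t \<in> I" "t' \<in> I"
  shows "orthonormal_basis (g t x) (D' x) = orthonormal_basis (g t' x) (D' x)"
proof
  fix B
  have "g t x u w = g t' x u w" if "B \<subseteq> D' x" "u \<in> B" "w \<in> B" for u w
    using metric_leafwise_constant[OF _ _ assms, of u x w] that D'(2) by blast
  then show "orthonormal_basis (g t x) (D' x) B = orthonormal_basis (g t' x) (D' x) B"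
    by (cases "B \<subseteq> D' x") (simp_all add: orthonormal_basis_def)
qed

lemma leafwise_orthonormal_basis_exists:
  assumes "t \<in> I" "finite F" "D' x \<subseteq> span F"
  shows "\<exists>B. orthonormal_basis (g t x) (D' x) B"
proof (rule orthonormal_basis_exists[OF D'(1) assms(3,2)])
  note m = riemannian_metricD[OF metric[OF assms(1)]]
  show "g t x (a *\<^sub>R u + b *\<^sub>R v) w = a * g t x u w + b * g t x v w"
    if "u \<in> D' x" "v \<in> D' x" "w \<in> D' x" for a b u v w
    by (rule m(1)) (use that D'(2) in blast)+
  show "g t x u v = g t x v u" if "u \<in> D' x" "v \<in> D' x" for u v
    by (rule m(2)) (use that D'(2) in blast)+
  show "g t x v v > 0" if "v \<in> D' x" "v \<noteq> 0" for v
    by (rule m(3)) (use that D'(2) in blast)+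
qed

text \<open>The hypotheses \<open>fin\<close> and \<open>ext\<close> make the two choices in the definition of
  the mean curvature, of a basis and of local extensions, effective. Both choices agree at the two times, so
  the traces are compared summand by summand.\<close>

lemma mean_curvature_rescaled:
  assumes t: "t \<in> I" "\<tau> \<in> I"
    and fin: "finite F" "D' x \<subseteq> span F"
    and ext: "\<And>v. v \<in> D' x \<Longrightarrow> \<exists>X U. X x = v \<and> open U \<and> x \<in> U \<and> section_on A D' U X"
    and E: "\<And>U X Y. open U \<Longrightarrow> x \<in> U \<Longrightarrow> section_on A D' U X \<Longrightarrow> section_on A D' U Y \<Longrightarrow>
      second_fundamental_form D D' (nabla t) X Y x = E *\<^sub>R second_fundamental_form D D' (nabla \<tau>) X Y x"
  shows "mean_curvature A D D' (g t) (nabla t) x = E *\<^sub>R mean_curvature A D D' (g \<tau>) (nabla \<tau>) x"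
proof -
  define B where "B = (SOME B. orthonormal_basis (g t x) (D' x) B)"
  have B\<tau>: "(SOME B. orthonormal_basis (g \<tau> x) (D' x) B) = B"
    unfolding B_def orthonormal_basis_constant[OF t] ..
  have "orthonormal_basis (g t x) (D' x) B"
    unfolding B_def using leafwise_orthonormal_basis_exists[OF t(1) fin] by (rule someI_ex)
  then have "B \<subseteq> D' x" by (simp add: orthonormal_basis_def)
  have "second_fundamental_form D D' (nabla t) (local_extension A D' x e) (local_extension A D' x e) x =
      E *\<^sub>R second_fundamental_form D D' (nabla \<tau>) (local_extension A D' x e) (local_extension A D' x e) x"
    if "e \<in> B" for e
  proof -
    have "e \<in> D' x" using that \<open>B \<subseteq> D' x\<close> by (rule rev_subsetD)
    then have "\<exists>X. X x = e \<and> (\<exists>U. open U \<and> x \<in> U \<and> section_on A D' U X)"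
      using ext[of e] by simp
    then have "\<exists>U. open U \<and> x \<in> U \<and> section_on A D' U (local_extension A D' x e)"
      unfolding local_extension_def by (rule someI2_ex) (erule conjunct2)
    then obtain U where U: "open U" "x \<in> U" "section_on A D' U (local_extension A D' x e)" by blast
    then show ?thesis by (intro E)
  qed
  then show ?thesis
    unfolding mean_curvature_def B\<tau> B_def[symmetric] scaleR_sum_right by (rule sum.cong[OF refl])
qed

end

section \<open>The variation formulas\<close>

theorem lemma2:
  fixes A \<F> :: "('a::{t2_space, second_countable_topology}, (real^'p) \<times> (real^'n)) chart set"
    and D D\<^sub>\<F> :: "'a \<Rightarrow> 'a tvec set"
    and I :: "real set"
    and g :: "real \<Rightarrow> 'a metric"
    and nabla :: "real \<Rightarrow> 'a connection"
    and s :: "real \<Rightarrow> 'a \<Rightarrow> real"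
  assumes "closed_manifold A"
    and "foliated_atlas A \<F>"
    and D\<^sub>\<F>: "D\<^sub>\<F> = tangent_distribution A \<F>"
    and "smooth_distribution A CARD('n) D"
    and "complementary A D D\<^sub>\<F>"
    and "open I" and "is_interval I"
    and "smooth_metric_family A I g"
    and "\<And>t. t \<in> I \<Longrightarrow> adapted D D\<^sub>\<F> (g t)"
    and "\<And>t. t \<in> I \<Longrightarrow> levi_civita A (g t) (nabla t)"
    and "smooth_family_on A I UNIV s"
    and "\<And>t x v w. t \<in> I \<Longrightarrow> v \<in> tangent_space A x \<Longrightarrow> w \<in> tangent_space A x \<Longrightarrow>
      ((\<lambda>\<tau>. g \<tau> x v w) has_real_derivative s t x * perp_metric D D\<^sub>\<F> (g t) x v w) (at t)"
  shows "(\<forall>t\<in>I. \<forall>U X Y. open U \<longrightarrow> section_on A D\<^sub>\<F> U X \<longrightarrow> section_on A D\<^sub>\<F> U Y \<longrightarrow>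
        (\<forall>x\<in>U. has_tvec_derivative
          (\<lambda>\<tau>. second_fundamental_form D D\<^sub>\<F> (nabla \<tau>) X Y x)
          ((- s t x) *\<^sub>R second_fundamental_form D D\<^sub>\<F> (nabla t) X Y x) t))
    \<and> (\<forall>t\<in>I. \<forall>x. has_tvec_derivative
        (\<lambda>\<tau>. mean_curvature A D D\<^sub>\<F> (g \<tau>) (nabla \<tau>) x)
        ((- s t x) *\<^sub>R mean_curvature A D D\<^sub>\<F> (g t) (nabla t) x) t)
    \<and> (\<forall>t\<^sub>0\<in>I. \<forall>t\<in>I. harmonic A D D\<^sub>\<F> (g t\<^sub>0) (nabla t\<^sub>0) \<longrightarrow> harmonic A D D\<^sub>\<F> (g t) (nabla t))
    \<and> (\<forall>t\<^sub>0\<in>I. \<forall>t\<in>I. totally_geodesic A D D\<^sub>\<F> (nabla t\<^sub>0) \<longrightarrow> totally_geodesic A D D\<^sub>\<F> (nabla t))"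
proof -
  note F = assms(2) and D\<F> = assms(3)
  have A: "smooth_atlas A" using assms(1) by (simp add: closed_manifold_def)
  interpret transverse_conformal_variation A D D\<^sub>\<F> "CARD('n)" I g nabla s
  proof
    show "subspace (D\<^sub>\<F> x)" for x unfolding D\<F> by (rule subspace_tangent_distribution)
    show "D\<^sub>\<F> x \<subseteq> tangent_space A x" for x unfolding D\<F> using tangent_distributionD(1) by blast
    show "lie_bracket A X Y x \<in> D\<^sub>\<F> x"
      if "open U" "x \<in> U" "section_on A D\<^sub>\<F> U X" "section_on A D\<^sub>\<F> U Y" "lie_bracket A X Y x \<in> tangent_space A x"
      for U X Y x
      using tangent_distribution_involutive[OF A F] that unfolding D\<F> .
    show "riemannian_metric A (g t)" if "t \<in> I" for t
      using assms(8) that unfolding smooth_metric_family_def by (elim conjE) (rule bspec)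
  qed (fact A assms(4,5,7,9,10,12))+
  obtain E where E1: "\<And>t x. t \<in> I \<Longrightarrow> E t x t = 1"
    and Epos: "\<And>t x \<tau>. t \<in> I \<Longrightarrow> \<tau> \<in> I \<Longrightarrow> E t x \<tau> > 0"
    and E': "\<And>t x. t \<in> I \<Longrightarrow> (E t x has_real_derivative s t x) (at t)"
    and h: "\<And>t x \<tau> U X Y. t \<in> I \<Longrightarrow> \<tau> \<in> I \<Longrightarrow> open U \<Longrightarrow> x \<in> U \<Longrightarrow>
      section_on A D\<^sub>\<F> U X \<Longrightarrow> section_on A D\<^sub>\<F> U Y \<Longrightarrow>
      second_fundamental_form D D\<^sub>\<F> (nabla t) X Y x =
        E t x \<tau> *\<^sub>R second_fundamental_form D D\<^sub>\<F> (nabla \<tau>) X Y x"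
  proof -
    \<comment> \<open>Choose the factor of \<open>second_fundamental_form_rescaled\<close> once for every time and point.\<close>
    define P where "P t x E \<longleftrightarrow> E t = 1 \<and> (\<forall>\<tau>\<in>I. E \<tau> > 0) \<and> (E has_real_derivative s t x) (at t) \<and>
      (\<forall>\<tau>\<in>I. \<forall>U X Y. open U \<longrightarrow> x \<in> U \<longrightarrow> section_on A D\<^sub>\<F> U X \<longrightarrow> section_on A D\<^sub>\<F> U Y \<longrightarrow>
        second_fundamental_form D D\<^sub>\<F> (nabla t) X Y x = E \<tau> *\<^sub>R second_fundamental_form D D\<^sub>\<F> (nabla \<tau>) X Y x)"
      for t x E
    have "\<exists>E. P t x E" if "t \<in> I" for t x
      by (rule second_fundamental_form_rescaled[OF that, of x], rule exI, unfold P_def,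
          intro conjI ballI allI impI; assumption?)
    then have P: "P t x (SOME E. P t x E)" if "t \<in> I" for t x using that by (metis someI_ex)
    show thesis
      by (rule that[of "\<lambda>t x. SOME E. P t x E"]) (use P in \<open>unfold P_def, blast\<close>)+
  qed
  have H: "mean_curvature A D D\<^sub>\<F> (g t) (nabla t) x = E t x \<tau> *\<^sub>R mean_curvature A D D\<^sub>\<F> (g \<tau>) (nabla \<tau>) x"
    if t: "t \<in> I" "\<tau> \<in> I" for t \<tau> x
  proof -
    obtain B where B: "finite B" "D\<^sub>\<F> x \<subseteq> span B"
      using tangent_distribution_finite_span[OF A F] unfolding D\<F> by blast
    show ?thesis
    proof (rule mean_curvature_rescaled[OF t B])
      show "\<exists>X U. X x = v \<and> open U \<and> x \<in> U \<and> section_on A D\<^sub>\<F> U X" if "v \<in> D\<^sub>\<F> x" for v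
        using tangent_distribution_local_section[OF A F] that unfolding D\<F> .
    qed (rule h[OF t])
  qed
  show ?thesis
  proof (intro conjI ballI allI impI)
    fix t U X Y x
    assume t: "t \<in> I" and *: "open U" "section_on A D\<^sub>\<F> U X" "section_on A D\<^sub>\<F> U Y" "x \<in> U"
    show "has_tvec_derivative (\<lambda>\<tau>. second_fundamental_form D D\<^sub>\<F> (nabla \<tau>) X Y x)
        ((- s t x) *\<^sub>R second_fundamental_form D D\<^sub>\<F> (nabla t) X Y x) t"
      by (rule has_tvec_derivative_rescaled[OF assms(6) t Epos[OF t] E1[OF t] E'[OF t] h[OF t _ *(1,4,2,3)]])
  next
    fix t x assume t: "t \<in> I"
    show "has_tvec_derivative (\<lambda>\<tau>. mean_curvature A D D\<^sub>\<F> (g \<tau>) (nabla \<tau>) x)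
        ((- s t x) *\<^sub>R mean_curvature A D D\<^sub>\<F> (g t) (nabla t) x) t"
      by (rule has_tvec_derivative_rescaled[OF assms(6) t Epos[OF t] E1[OF t] E'[OF t] H[OF t]])
  next
    fix t\<^sub>0 t assume t: "t\<^sub>0 \<in> I" "t \<in> I" and har: "harmonic A D D\<^sub>\<F> (g t\<^sub>0) (nabla t\<^sub>0)"
    show "harmonic A D D\<^sub>\<F> (g t) (nabla t)"
      using har H[OF t(2,1)] by (simp add: harmonic_def)
  next
    fix t\<^sub>0 t assume t: "t\<^sub>0 \<in> I" "t \<in> I" and geo: "totally_geodesic A D D\<^sub>\<F> (nabla t\<^sub>0)"
    show "totally_geodesic A D D\<^sub>\<F> (nabla t)"
      unfolding totally_geodesic_def
    proof (intro allI impI ballI)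
      fix U X Y x assume *: "open U" "section_on A D\<^sub>\<F> U X" "section_on A D\<^sub>\<F> U Y" "x \<in> U"
      have "second_fundamental_form D D\<^sub>\<F> (nabla t\<^sub>0) X Y x = 0"
        using geo * unfolding totally_geodesic_def by blast
      then show "second_fundamental_form D D\<^sub>\<F> (nabla t) X Y x = 0"
        using h[OF t(2,1) *(1,4,2,3)] by simp
    qed
  qed
qed

end
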